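(* Let $G$ be a $1$-John domain in $\mathbb{R}^n$, $n\ge2$, let $\tau,\delta\in(0,1)$, $p<n/\delta$ and $1<p\le q\le \frac{np}{n-\delta p}$. Then there is $c<\infty$ such that for all $u\in L^p(G)$ \[ \int_G|u(x)-u_G|^q\,dx\le c\left(\int_G\int_{G\cap B^n(x,\tau\operatorname{dist}(x,\partial G))}\frac{|u(x)-u(y)|^p}{|x-y|^{n+\delta p}}\,dy\,dx\right)^{q/p}. \]
   Context: A bounded domain $G\subset\mathbb{R}^n$ is a $1$-John domain if there are $x_0\in G$ and $c>0$ such that every $x\in G$ can be joined to $x_0$ by a rectifiable arc-length parametrized curve $\gamma:[0,l]\to G$ with $\gamma(0)=x$, $\gamma(l)=x_0$, $l\le c$, and $\operatorname{dist}(\gamma(t),\partial G)\ge t/c$ for $t\in[0,l]$. $u_G$ is the mean of $u$ over $G$. *)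

theory Defs
  imports "HOL-Analysis.Analysis"
begin

definition polygonal_sums :: "(real \<Rightarrow> 'a::metric_space) \<Rightarrow> real \<Rightarrow> real \<Rightarrow> real set" where
  "polygonal_sums \<gamma> s t =
     {(\<Sum>i<length ts - 1. dist (\<gamma> (ts ! i)) (\<gamma> (ts ! Suc i))) | ts.
        sorted ts \<and> set ts \<subseteq> {s..t}}"

definition arclength_parametrized :: "(real \<Rightarrow> 'a::metric_space) \<Rightarrow> real \<Rightarrow> bool" where
  "arclength_parametrized \<gamma> l \<longleftrightarrow> 0 \<le> l \<and>
     (\<forall>s t. 0 \<le> s \<and> s \<le> t \<and> t \<le> l \<longrightarrow>
        bdd_above (polygonal_sums \<gamma> s t) \<and> Sup (polygonal_sums \<gamma> s t) = t - s)"

definition john_domain :: "'a::euclidean_space set \<Rightarrow> bool" where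
  "john_domain G \<longleftrightarrow> open G \<and> connected G \<and> bounded G \<and>
     (\<exists>x0\<in>G. \<exists>c>0. \<forall>x\<in>G. \<exists>\<gamma> l.
        arclength_parametrized \<gamma> l \<and> \<gamma> ` {0..l} \<subseteq> G \<and>
        \<gamma> 0 = x \<and> \<gamma> l = x0 \<and> l \<le> c \<and>
        (\<forall>t\<in>{0..l}. infdist (\<gamma> t) (frontier G) \<ge> t / c))"

end

theory Submission
  imports Defs
begin

text \<open>
  Let \<open>g(x)\<close> be the \<open>p\<close>-th root of the inner integral at \<open>x\<close>. If a ball \<open>B\<close> of radius comparable
  to \<open>r\<close> lies in \<open>ball y (C * r)\<close> and in the domain of the inner integral at \<open>y\<close>, then
  \<open>u(y)\<close> differs from the average of \<open>u\<close> over \<open>B\<close> by at most a multiple of \<open>r\<^bsup>\<delta>\<^esup> g(y)\<close>.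
  Along the John curve of \<open>x\<close> take balls with centres \<open>\<gamma>(t\<^sub>i)\<close> and radii \<open>\<epsilon> t\<^sub>i\<close>, where
  \<open>t\<^sub>i = c (1 - \<epsilon>)\<^bsup>i\<^esup>\<close>. Consecutive averages of \<open>u\<close> differ by at most a multiple of
  \<open>t\<^sub>i\<^bsup>\<delta>\<^esup>\<close> times the average of \<open>g\<close>, and this average is bounded both by the maximal function
  \<open>Mg(x)\<close> and by a multiple of \<open>t\<^sub>i\<^bsup>-n/p\<^esup> A\<close>, \<open>A\<close> being the \<open>L\<^bsup>p\<^esup>\<close> norm of \<open>g\<close>. Hedberg's
  argument turns the sum over \<open>i\<close> into \<open>A\<^bsup>1-p/q\<^esup> Mg(x)\<^bsup>p/q\<^esup>\<close>, and the \<open>L\<^bsup>p\<^esup>\<close> bound for the maximal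
  function gives the inequality with the average over the central ball in place of the mean.
\<close>

section \<open>Lebesgue measure\<close>

text \<open>Tonelli and the measurability of parameter integrals over \<open>lebesgue\<close> rest
  on this. Completion leaves the measure of Borel sets unchanged, so a countable cover for
  \<open>lborel\<close> serves again.\<close>

lemma sigma_finite_lebesgue: "sigma_finite_measure (lebesgue :: 'a::euclidean_space measure)"
proof
  obtain A :: "'a set set" where A: "countable A" "A \<subseteq> sets lborel" "\<Union>A = space lborel"
    "\<forall>a\<in>A. emeasure lborel a \<noteq> \<infinity>"
    using lborel.sigma_finite_countable by blast
  show "\<exists>A::'a set set. countable A \<and> A \<subseteq> sets lebesgue \<and> \<Union>A = space lebesgue \<and>
      (\<forall>a\<in>A. emeasure lebesgue a \<noteq> \<infinity>)"
    using A by (intro exI[of _ A]) (auto intro: sets_completionI_sets)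
qed

interpretation lebesgue: sigma_finite_measure "lebesgue :: 'a::euclidean_space measure"
  by (rule sigma_finite_lebesgue)

lemma open_in_sets_lebesgue: "open (S::'a::euclidean_space set) \<Longrightarrow> S \<in> sets lebesgue"
  by (simp add: sets_completionI_sets)

lemma ball_lebesgue_measurable[measurable]: "ball (w::'a::euclidean_space) r \<in> sets lebesgue"
  by simp

lemma ident_borel_measurable_lebesgue: "(\<lambda>x::'a::euclidean_space. x) \<in> borel_measurable lebesgue"
  by (rule measurable_completion) simp

lemma fst_borel_measurable: "(\<lambda>x. x) \<in> borel_measurable M \<Longrightarrow> fst \<in> borel_measurable (M \<Otimes>\<^sub>M N)"
  by (rule measurable_compose[OF measurable_fst, where g = "\<lambda>x. x"])

lemma snd_borel_measurable: "(\<lambda>x. x) \<in> borel_measurable N \<Longrightarrow> snd \<in> borel_measurable (M \<Otimes>\<^sub>M N)"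
  by (rule measurable_compose[OF measurable_snd, where g = "\<lambda>x. x"])

text \<open>The weight of the layer cake formula. It is applied with exponent \<open>p\<close>, and
  with exponent \<open>p - 1\<close>, where the integrand may be singular at 0.\<close>

lemma nn_integral_powr_interval:
  fixes a b :: real
  assumes "0 < a" "0 \<le> b"
  shows "(\<integral>\<^sup>+s. ennreal (a * s powr (a - 1)) * indicator {0<..<b} s \<partial>lborel) = ennreal (b powr a)"
proof -
  have "((\<lambda>s. s powr (a - 1)) has_integral b powr a / a) {0..b}"
    using has_integral_powr_from_0[of "a - 1" b] assms by simp
  from has_integral_mult_right[OF this, of a]
  have hi: "((\<lambda>s. a * s powr (a - 1)) has_integral b powr a) {0..b}"
    using assms by simp
  have "(\<integral>\<^sup>+s. ennreal (a * s powr (a - 1)) * indicator {0<..<b} s \<partial>lborel) =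
      (\<integral>\<^sup>+s. ennreal (a * s powr (a - 1)) * indicator {0..b} s \<partial>lborel)"
  proof (rule nn_integral_cong_AE)
    show "AE s in lborel. ennreal (a * s powr (a - 1)) * indicator {0<..<b} s =
        ennreal (a * s powr (a - 1)) * indicator {0..b} s"
      using AE_lborel_singleton[of 0] AE_lborel_singleton[of b]
      by eventually_elim (auto simp: indicator_def)
  qed
  also have "\<dots> = ennreal (b powr a)"
    by (rule nn_integral_has_integral_lebesgue'[OF _ hi]) (use assms in simp)
  finally show ?thesis .
qed

lemma emeasure_lebesgue_ball:
  fixes w :: "'a::euclidean_space"
  assumes "0 \<le> r"
  shows "emeasure lebesgue (ball w r) = ennreal (unit_ball_vol DIM('a) * r ^ DIM('a))"
  using emeasure_ball[OF assms, of w] assms by simp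

text \<open>Countable subadditivity with the sum written as an integral over
  \<open>count_space\<close>, so that the index set of a covering family needs no enumeration. The
  indicator of the union is at most the sum of the indicators.\<close>

lemma emeasure_UN_countable_le:
  assumes sets: "\<And>i. i \<in> I \<Longrightarrow> X i \<in> sets M" and I: "countable I"
  shows "emeasure M (\<Union>i\<in>I. X i) \<le> (\<integral>\<^sup>+i. emeasure M (X i) \<partial>count_space I)"
proof -
  have UN: "(\<Union>i\<in>I. X i) \<in> sets M"
    by (rule sets.countable_UN''[OF I sets])
  have "emeasure M (\<Union>i\<in>I. X i) = (\<integral>\<^sup>+x. indicator (\<Union>i\<in>I. X i) x \<partial>M)"
    using UN by simp
  also have "\<dots> \<le> (\<integral>\<^sup>+x. (\<integral>\<^sup>+i. indicator (X i) x \<partial>count_space I) \<partial>M)"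
  proof (rule nn_integral_mono)
    fix x
    show "indicator (\<Union>i\<in>I. X i) x \<le> (\<integral>\<^sup>+i. indicator (X i) x \<partial>count_space I)"
    proof (cases "x \<in> (\<Union>i\<in>I. X i)")
      case True
      then obtain j where j: "j \<in> I" "x \<in> X j" by auto
      show ?thesis
        using nn_integral_ge_point[OF j(1), of "\<lambda>i. indicator (X i) x"] j True by simp
    qed simp
  qed
  also have "\<dots> = (\<integral>\<^sup>+i. \<integral>\<^sup>+x. indicator (X i) x \<partial>M \<partial>count_space I)"
    by (rule nn_integral_count_space_nn_integral[OF I]) (use sets in simp)
  also have "\<dots> = (\<integral>\<^sup>+i. emeasure M (X i) \<partial>count_space I)"
    using sets by (intro nn_integral_cong) simp
  finally show ?thesis .
qed

section \<open>The maximal function\<close>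

text \<open>The superlevel set \<open>{Mf > s}\<close> of the uncentred maximal function with radii at most \<open>R\<close>.\<close>

definition max_level :: "('a::euclidean_space \<Rightarrow> real) \<Rightarrow> real \<Rightarrow> real \<Rightarrow> 'a set" where
  "max_level f R s = \<Union>{ball w r | w r. 0 < r \<and> r \<le> R \<and>
     (\<integral>\<^sup>+x\<in>ball w r. ennreal (f x) \<partial>lebesgue) > ennreal s * emeasure lebesgue (ball w r)}"

lemma open_max_level: "open (max_level f R s)"
  unfolding max_level_def by (rule open_Union) auto

text \<open>Weak type (1,1) by Vitali's covering lemma, which asks for bounded radii: countably many
  disjoint balls of the defining family cover the level set once their radii are multiplied by 5,
  and on each of them the measure is controlled by the integral of \<open>f\<close>.\<close>

lemma emeasure_max_level_le:
  fixes f :: "'a::euclidean_space \<Rightarrow> real"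
  assumes f[measurable]: "f \<in> borel_measurable lebesgue" and "0 < s"
  shows "emeasure lebesgue (max_level f R s) \<le> ennreal (5 ^ DIM('a) / s) * (\<integral>\<^sup>+x. ennreal (f x) \<partial>lebesgue)"
proof -
  let ?K = "{(w::'a, r). 0 < r \<and> r \<le> R \<and>
     (\<integral>\<^sup>+x\<in>ball w r. ennreal (f x) \<partial>lebesgue) > ennreal s * emeasure lebesgue (ball w r)}"
  have cov: "max_level f R s \<subseteq> (\<Union>i\<in>?K. ball (fst i) (snd i))"
    unfolding max_level_def by auto
  obtain C where C: "countable C" "C \<subseteq> ?K"
     "pairwise (\<lambda>i j. disjnt (ball (fst i) (snd i)) (ball (fst j) (snd j))) C"
     "max_level f R s \<subseteq> (\<Union>i\<in>C. ball (fst i) (5 * snd i))"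
    by (rule Vitali_covering_lemma_balls[OF cov, of R]) (simp_all add: split_beta)
  have disj: "disjoint_family_on (\<lambda>i. ball (fst i) (snd i)) C"
    using C(3) unfolding disjoint_family_on_def pairwise_def disjnt_def by blast
  have "emeasure lebesgue (max_level f R s) \<le> emeasure lebesgue (\<Union>i\<in>C. ball (fst i) (5 * snd i))"
    by (rule emeasure_mono[OF C(4)]) (intro open_in_sets_lebesgue open_UN ballI open_ball)
  also have "\<dots> \<le> (\<integral>\<^sup>+i. emeasure lebesgue (ball (fst i) (5 * snd i)) \<partial>count_space C)"
    by (rule emeasure_UN_countable_le) (use C(1) in auto)
  also have "\<dots> \<le> (\<integral>\<^sup>+i. ennreal (5 ^ DIM('a) / s) *
      (\<integral>\<^sup>+x\<in>ball (fst i) (snd i). ennreal (f x) \<partial>lebesgue) \<partial>count_space C)"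
  proof (rule nn_integral_mono)
    fix i assume "i \<in> space (count_space C)"
    then have i: "0 < snd i" "(\<integral>\<^sup>+x\<in>ball (fst i) (snd i). ennreal (f x) \<partial>lebesgue) >
        ennreal s * emeasure lebesgue (ball (fst i) (snd i))"
      using C(2) by auto
    have "emeasure lebesgue (ball (fst i) (5 * snd i)) =
        ennreal (5 ^ DIM('a)) * emeasure lebesgue (ball (fst i) (snd i))"
      using i(1) by (simp add: emeasure_lebesgue_ball power_mult_distrib ennreal_mult[symmetric]
          mult_ac del: emeasure_completion)
    also have "\<dots> = ennreal (5 ^ DIM('a) / s) * (ennreal s * emeasure lebesgue (ball (fst i) (snd i)))"
      using \<open>0 < s\<close> by (simp add: mult.assoc[symmetric] ennreal_mult[symmetric])
    also have "\<dots> \<le> ennreal (5 ^ DIM('a) / s) * (\<integral>\<^sup>+x\<in>ball (fst i) (snd i). ennreal (f x) \<partial>lebesgue)"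
      using i(2) by (intro mult_left_mono) auto
    finally show "emeasure lebesgue (ball (fst i) (5 * snd i)) \<le> \<dots>" .
  qed
  also have "\<dots> = ennreal (5 ^ DIM('a) / s) *
      (\<integral>\<^sup>+i. (\<integral>\<^sup>+x\<in>ball (fst i) (snd i). ennreal (f x) \<partial>lebesgue) \<partial>count_space C)"
    by (rule nn_integral_cmult) auto
  also have "(\<integral>\<^sup>+i. (\<integral>\<^sup>+x\<in>ball (fst i) (snd i). ennreal (f x) \<partial>lebesgue) \<partial>count_space C) =
      (\<integral>\<^sup>+x\<in>(\<Union>i\<in>C. ball (fst i) (snd i)). ennreal (f x) \<partial>lebesgue)"
  proof -
    have "(\<integral>\<^sup>+i. (\<integral>\<^sup>+x\<in>ball (fst i) (snd i). ennreal (f x) \<partial>lebesgue) \<partial>count_space C) =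
       (\<integral>\<^sup>+i. emeasure (density lebesgue (\<lambda>x. ennreal (f x))) (ball (fst i) (snd i)) \<partial>count_space C)"
      by (intro nn_integral_cong) (simp add: emeasure_density)
    \<comment> \<open>The balls of \<open>C\<close> are disjoint, so the measure with density
      \<open>f\<close> is additive over them.\<close>
    also have "\<dots> = emeasure (density lebesgue (\<lambda>x. ennreal (f x))) (\<Union>i\<in>C. ball (fst i) (snd i))"
      by (rule emeasure_UN_countable[symmetric]) (use C(1) disj in auto)
    also have "\<dots> = (\<integral>\<^sup>+x\<in>(\<Union>i\<in>C. ball (fst i) (snd i)). ennreal (f x) \<partial>lebesgue)"
      by (rule emeasure_density) (simp, intro open_in_sets_lebesgue open_UN ballI open_ball)
    finally show ?thesis .
  qed
  also have "\<dots> \<le> (\<integral>\<^sup>+x. ennreal (f x) \<partial>lebesgue)"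
    by (intro nn_integral_mono) (auto simp: indicator_def)
  finally show ?thesis
    by (simp add: mult_left_mono)
qed

text \<open>The values of \<open>f\<close> not exceeding \<open>s / 2\<close> contribute at most
  \<open>s / 2\<close> to any average. Hence an average of \<open>f\<close> above \<open>s\<close>
  forces an average above \<open>s / 2\<close> of the truncation \<open>h\<close>, to which the weak
  type bound applies.\<close>

lemma emeasure_max_level_truncated_le:
  fixes f :: "'a::euclidean_space \<Rightarrow> real"
  assumes f[measurable]: "f \<in> borel_measurable lebesgue" and "0 < s"
  shows "emeasure lebesgue (max_level f R s) \<le>
    ennreal (2 * 5 ^ DIM('a) / s) * (\<integral>\<^sup>+x\<in>{x. s < 2 * f x}. ennreal (f x) \<partial>lebesgue)"
proof -
  define h where "h x = f x * indicator {x. s < 2 * f x} x" for x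
  have h[measurable]: "h \<in> borel_measurable lebesgue"
    unfolding h_def by measurable
  have "max_level f R s \<subseteq> max_level h R (s / 2)"
  proof -
    have "(\<integral>\<^sup>+x\<in>ball w r. ennreal (h x) \<partial>lebesgue) > ennreal (s / 2) * emeasure lebesgue (ball w r)"
      if r: "0 < r" and gt: "(\<integral>\<^sup>+x\<in>ball w r. ennreal (f x) \<partial>lebesgue) > ennreal s * emeasure lebesgue (ball w r)"
      for w r
    proof (rule ccontr)
      let ?m = "emeasure lebesgue (ball w r)"
      assume neg: "\<not> ?thesis"
      have "(\<integral>\<^sup>+x\<in>ball w r. ennreal (f x) \<partial>lebesgue) \<le>
          (\<integral>\<^sup>+x. ennreal (h x) * indicator (ball w r) x + ennreal (s / 2) * indicator (ball w r) x \<partial>lebesgue)"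
      proof (rule nn_integral_mono)
        fix x
        have "ennreal (f x) \<le> ennreal (h x) + ennreal (s / 2)"
          using \<open>0 < s\<close> by (cases "s < 2 * f x") (auto simp: h_def intro!: ennreal_leI)
        then show "ennreal (f x) * indicator (ball w r) x \<le>
            ennreal (h x) * indicator (ball w r) x + ennreal (s / 2) * indicator (ball w r) x"
          by (auto simp: indicator_def)
      qed
      also have "\<dots> = (\<integral>\<^sup>+x\<in>ball w r. ennreal (h x) \<partial>lebesgue) + ennreal (s / 2) * ?m"
        by (subst nn_integral_add) (auto simp: nn_integral_cmult_indicator)
      also have "\<dots> \<le> ennreal (s / 2) * ?m + ennreal (s / 2) * ?m"
        using neg by (intro add_mono) auto
      also have "\<dots> = ennreal s * ?m"
        using \<open>0 < s\<close> by (simp add: distrib_right[symmetric] ennreal_plus[symmetric] del: ennreal_plus)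
      finally show False using gt by auto
    qed
    then show ?thesis
      unfolding max_level_def by (intro Union_mono) blast
  qed
  then have "emeasure lebesgue (max_level f R s) \<le> emeasure lebesgue (max_level h R (s / 2))"
    by (rule emeasure_mono) (intro open_in_sets_lebesgue open_max_level)
  also have "\<dots> \<le> ennreal (5 ^ DIM('a) / (s / 2)) * (\<integral>\<^sup>+x. ennreal (h x) \<partial>lebesgue)"
    using \<open>0 < s\<close> by (intro emeasure_max_level_le) auto
  also have "(\<integral>\<^sup>+x. ennreal (h x) \<partial>lebesgue) = (\<integral>\<^sup>+x\<in>{x. s < 2 * f x}. ennreal (f x) \<partial>lebesgue)"
    by (intro nn_integral_cong) (auto simp: h_def indicator_def)
  finally show ?thesis by (simp add: mult.commute)
qed

lemma snd_borel_lborel: "snd \<in> borel_measurable (M \<Otimes>\<^sub>M lborel)"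
  by (rule snd_borel_measurable) simp

text \<open>Supplies the joint measurability for Tonelli. For a fixed ball the admissible levels
  \<open>s\<close> form an open set, so the graph is a union of open products and therefore
  open.\<close>

lemma sets_max_level_graph:
  "{(x, s). x \<in> max_level f R s} \<in> sets ((lebesgue :: 'a::euclidean_space measure) \<Otimes>\<^sub>M (lborel :: real measure))"
proof -
  define E where "E = {(x, s). x \<in> max_level f R s}"
  let ?I = "\<lambda>w r. \<integral>\<^sup>+x\<in>ball w r. ennreal (f x) \<partial>lebesgue"
  let ?m = "\<lambda>w r. emeasure lebesgue (ball w r)"
  have "E = (\<Union>(w, r)\<in>{(w, r). 0 < r \<and> r \<le> R}. ball w r \<times> {s. ennreal s * ?m w r < ?I w r})"
    unfolding E_def max_level_def by auto
  moreover have "open \<dots>"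
  proof (intro open_UN ballI)
    fix i :: "'a \<times> real" assume "i \<in> {(w, r). 0 < r \<and> r \<le> R}"
    obtain w r where i: "i = (w, r)" by fastforce
    have "continuous_on UNIV (\<lambda>s::real. ?m w r * ennreal s)"
      by (intro ennreal_continuous_on_cmult continuous_on_ennreal continuous_on_id)
        (use emeasure_bounded_finite[of "ball w r"] in simp)
    then have "open {s. ?m w r * ennreal s < ?I w r}"
      by (intro open_Collect_less) auto
    then show "open (case i of (w, r) \<Rightarrow> ball w r \<times> {s. ennreal s * ?m w r < ?I w r})"
      unfolding i by (simp add: open_Times mult.commute)
  qed
  ultimately have "E \<in> sets borel" by simp
  then have [measurable]: "E \<in> sets (borel \<Otimes>\<^sub>M borel)" by (simp only: borel_prod)
  have [measurable]: "(\<lambda>z. (fst z, snd z)) \<in> (lebesgue :: 'a measure) \<Otimes>\<^sub>M (lborel :: real measure) \<rightarrow>\<^sub>M borel \<Otimes>\<^sub>M borel"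
    by (intro measurable_Pair fst_borel_measurable snd_borel_measurable ident_borel_measurable_lebesgue) simp
  have "(\<lambda>z. (fst z, snd z)) -` E \<inter> space (lebesgue \<Otimes>\<^sub>M lborel) \<in> sets ((lebesgue :: 'a measure) \<Otimes>\<^sub>M (lborel :: real measure))"
    by measurable
  then show ?thesis
    unfolding E_def[symmetric] by (simp add: space_pair_measure)
qed

text \<open>The bound for the maximal function in \<open>L^p\<close>. By the layer cake formula the
  inner integral on the left is the \<open>p\<close>-th power of the maximal function at
  \<open>x\<close>. The truncated weak type bound leaves, after Tonelli, an integral over
  \<open>s\<close> between 0 and \<open>2 * f x\<close>, whose weight is integrable at 0 because
  \<open>p > 1\<close>.\<close>

lemma nn_integral_max_level_le:
  fixes f :: "'a::euclidean_space \<Rightarrow> real"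
  assumes f[measurable]: "f \<in> borel_measurable lebesgue" and nonneg: "\<And>x. 0 \<le> f x" and p: "1 < p"
  shows "(\<integral>\<^sup>+x. (\<integral>\<^sup>+s. ennreal (p * s powr (p - 1)) * indicator {0<..} s * indicator (max_level f R s) x \<partial>lborel) \<partial>lebesgue)
    \<le> ennreal (5 ^ DIM('a) * 2 powr p * p / (p - 1)) * (\<integral>\<^sup>+x. ennreal (f x powr p) \<partial>lebesgue)"
proof -
  interpret pair: pair_sigma_finite "lebesgue :: 'a measure" "lborel :: real measure" ..
  define E where "E = {(x, s). x \<in> max_level f R s}"
  have [measurable]: "E \<in> sets ((lebesgue :: 'a measure) \<Otimes>\<^sub>M (lborel :: real measure))"
    unfolding E_def by (rule sets_max_level_graph)
  note snd_borel_lborel[measurable]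
  let ?w = "\<lambda>s. ennreal (p * s powr (p - 1)) * indicator {0<..} s"
  have "(\<lambda>z. ?w (snd z) * indicator E z) \<in> borel_measurable ((lebesgue :: 'a measure) \<Otimes>\<^sub>M (lborel :: real measure))"
    by measurable
  from pair.Fubini[OF this]
  have "(\<integral>\<^sup>+x. (\<integral>\<^sup>+s. ?w s * indicator (max_level f R s) x \<partial>lborel) \<partial>lebesgue)
      = (\<integral>\<^sup>+s. (\<integral>\<^sup>+x. ?w s * indicator (max_level f R s) x \<partial>lebesgue) \<partial>lborel)"
    by (simp add: E_def indicator_def)
  also have "\<dots> = (\<integral>\<^sup>+s. ?w s * emeasure lebesgue (max_level f R s) \<partial>lborel)"
    by (intro nn_integral_cong nn_integral_cmult_indicator open_in_sets_lebesgue open_max_level)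
  also have "\<dots> \<le> (\<integral>\<^sup>+s. (\<integral>\<^sup>+x. ennreal (2 * 5 ^ DIM('a) * p / (p - 1)) * ennreal (f x) *
      (ennreal ((p - 1) * s powr (p - 1 - 1)) * indicator {0<..<2 * f x} s) \<partial>lebesgue) \<partial>lborel)"
  proof (rule nn_integral_mono)
    fix s :: real
    show "?w s * emeasure lebesgue (max_level f R s) \<le> (\<integral>\<^sup>+x. ennreal (2 * 5 ^ DIM('a) * p / (p - 1)) * ennreal (f x) *
      (ennreal ((p - 1) * s powr (p - 1 - 1)) * indicator {0<..<2 * f x} s) \<partial>lebesgue)"
    proof (cases "0 < s")
      case True
      have "?w s * emeasure lebesgue (max_level f R s) \<le> ennreal (p * s powr (p - 1)) *
         (ennreal (2 * 5 ^ DIM('a) / s) * (\<integral>\<^sup>+x\<in>{x. s < 2 * f x}. ennreal (f x) \<partial>lebesgue))"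
        using True emeasure_max_level_truncated_le[OF f True, of R] by (simp add: mult_left_mono)
      also have "\<dots> = ennreal (p * s powr (p - 1) * (2 * 5 ^ DIM('a) / s)) * (\<integral>\<^sup>+x\<in>{x. s < 2 * f x}. ennreal (f x) \<partial>lebesgue)"
        using True p by (simp add: mult.assoc[symmetric] ennreal_mult[symmetric])
      \<comment> \<open>The weight is normalised to the form of
        \<open>nn_integral_powr_interval\<close> with exponent \<open>p - 1\<close>; this is where
        the factor \<open>p / (p - 1)\<close> arises.\<close>
      also have "p * s powr (p - 1) * (2 * 5 ^ DIM('a) / s) = (2 * 5 ^ DIM('a) * p / (p - 1)) * ((p - 1) * s powr (p - 1 - 1))"
        using True p by (simp add: powr_diff power2_eq_square)
      also have "ennreal \<dots> * (\<integral>\<^sup>+x\<in>{x. s < 2 * f x}. ennreal (f x) \<partial>lebesgue) =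
        (\<integral>\<^sup>+x. ennreal ((2 * 5 ^ DIM('a) * p / (p - 1)) * ((p - 1) * s powr (p - 1 - 1))) * (ennreal (f x) * indicator {x. s < 2 * f x} x) \<partial>lebesgue)"
        by (rule nn_integral_cmult[symmetric]) measurable
      also have "\<dots> = (\<integral>\<^sup>+x. ennreal (2 * 5 ^ DIM('a) * p / (p - 1)) * ennreal (f x) *
        (ennreal ((p - 1) * s powr (p - 1 - 1)) * indicator {0<..<2 * f x} s) \<partial>lebesgue)"
      proof (rule nn_integral_cong)
        fix x
        have "0 \<le> 2 * 5 ^ DIM('a) * p / (p - 1)" "0 \<le> (p - 1) * s powr (p - 1 - 1)"
          using p by auto
        from ennreal_mult[OF this]
        show "ennreal ((2 * 5 ^ DIM('a) * p / (p - 1)) * ((p - 1) * s powr (p - 1 - 1))) * (ennreal (f x) * indicator {x. s < 2 * f x} x) =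
          ennreal (2 * 5 ^ DIM('a) * p / (p - 1)) * ennreal (f x) *
            (ennreal ((p - 1) * s powr (p - 1 - 1)) * indicator {0<..<2 * f x} s)"
          using True by (simp add: indicator_def mult.assoc mult.left_commute del: ennreal_mult)
      qed
      finally show ?thesis .
    qed simp
  qed
  also have "\<dots> = (\<integral>\<^sup>+x. (\<integral>\<^sup>+s. ennreal (2 * 5 ^ DIM('a) * p / (p - 1)) * ennreal (f x) *
      (ennreal ((p - 1) * s powr (p - 1 - 1)) * indicator {0<..<2 * f x} s) \<partial>lborel) \<partial>lebesgue)"
  proof -
    have [measurable]: "(\<lambda>z. indicator {0<..<2 * f (fst z)} (snd z) :: ennreal) \<in> borel_measurable ((lebesgue :: 'a measure) \<Otimes>\<^sub>M (lborel :: real measure))"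
    proof -
      have "(\<lambda>z. indicator {0<..<2 * f (fst z)} (snd z) :: ennreal) = (\<lambda>z. if 0 < snd z \<and> snd z < 2 * f (fst z) then 1 else 0)"
        by (auto simp: indicator_def)
      then show ?thesis by simp
    qed
    show ?thesis
      using pair.Fubini[of "\<lambda>z. ennreal (2 * 5 ^ DIM('a) * p / (p - 1)) * ennreal (f (fst z)) *
      (ennreal ((p - 1) * snd z powr (p - 1 - 1)) * indicator {0<..<2 * f (fst z)} (snd z))"]
      by (simp add: split_beta)
  qed
  also have "\<dots> = (\<integral>\<^sup>+x. ennreal (5 ^ DIM('a) * 2 powr p * p / (p - 1)) * ennreal (f x powr p) \<partial>lebesgue)"
  proof (rule nn_integral_cong)
    fix x
    have "(\<integral>\<^sup>+s. ennreal (2 * 5 ^ DIM('a) * p / (p - 1)) * ennreal (f x) *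
      (ennreal ((p - 1) * s powr (p - 1 - 1)) * indicator {0<..<2 * f x} s) \<partial>lborel) =
       ennreal (2 * 5 ^ DIM('a) * p / (p - 1)) * ennreal (f x) * ennreal ((2 * f x) powr (p - 1))"
      using nn_integral_powr_interval[of "p - 1" "2 * f x"] p nonneg[of x]
      by (subst nn_integral_cmult) auto
    also have "\<dots> = ennreal (2 * 5 ^ DIM('a) * p / (p - 1) * f x * (2 * f x) powr (p - 1))"
      using p nonneg[of x] by (simp add: ennreal_mult[symmetric])
    also have "2 * 5 ^ DIM('a) * p / (p - 1) * f x * (2 * f x) powr (p - 1) =
        5 ^ DIM('a) * 2 powr p * p / (p - 1) * f x powr p"
      using p nonneg[of x] by (cases "f x = 0") (auto simp: powr_diff powr_mult field_simps)
    also have "ennreal \<dots> = ennreal (5 ^ DIM('a) * 2 powr p * p / (p - 1)) * ennreal (f x powr p)"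
      by (rule ennreal_mult) (use p in auto)
    finally show "(\<integral>\<^sup>+s. ennreal (2 * 5 ^ DIM('a) * p / (p - 1)) * ennreal (f x) *
      (ennreal ((p - 1) * s powr (p - 1 - 1)) * indicator {0<..<2 * f x} s) \<partial>lborel) =
      ennreal (5 ^ DIM('a) * 2 powr p * p / (p - 1)) * ennreal (f x powr p)" .
  qed
  also have "\<dots> = ennreal (5 ^ DIM('a) * 2 powr p * p / (p - 1)) * (\<integral>\<^sup>+x. ennreal (f x powr p) \<partial>lebesgue)"
    by (rule nn_integral_cmult) measurable
  finally show ?thesis .
qed

section \<open>Averages over balls\<close>

definition set_average :: "('a::euclidean_space \<Rightarrow> real) \<Rightarrow> 'a set \<Rightarrow> real" where
  "set_average u B = (LINT x:B|lebesgue. u x) / measure lebesgue B"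

lemma measure_lebesgue_ball:
  fixes w :: "'a::euclidean_space"
  assumes "0 \<le> r"
  shows "measure lebesgue (ball w r) = unit_ball_vol DIM('a) * r ^ DIM('a)"
  using content_ball[OF assms, of w] by simp

text \<open>The triangle inequality for the integral of \<open>a - u\<close> over \<open>B\<close>,
  multiplied by the measure of \<open>B\<close> to avoid a division in
  \<open>ennreal\<close>.\<close>

lemma set_average_deviation:
  assumes B: "B \<in> sets lebesgue" "emeasure lebesgue B \<noteq> \<infinity>" "0 < measure lebesgue B"
    and u: "set_integrable lebesgue B u"
  shows "ennreal (\<bar>a - set_average u B\<bar> * measure lebesgue B) \<le> (\<integral>\<^sup>+x\<in>B. ennreal \<bar>a - u x\<bar> \<partial>lebesgue)"
proof -
  have c: "set_integrable lebesgue B (\<lambda>x. a)"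
    using B unfolding set_integrable_def by (simp add: less_top[symmetric])
  have eq: "(LINT x:B|lebesgue. a - u x) = (a - set_average u B) * measure lebesgue B"
  proof -
    have "(LINT x:B|lebesgue. a - u x) = (LINT x:B|lebesgue. a) - (LINT x:B|lebesgue. u x)"
      by (rule set_integral_diff(2)[OF c u])
    also have "(LINT x:B|lebesgue. a) = a * measure lebesgue B"
      using B by (simp add: set_lebesgue_integral_def)
    finally show ?thesis
      using B(3) by (simp add: set_average_def left_diff_distrib)
  qed
  have "integrable lebesgue (\<lambda>x. indicator B x *\<^sub>R (a - u x))"
    using set_integral_diff(1)[OF c u] unfolding set_integrable_def .
  then have "ennreal (norm (LINT x|lebesgue. indicator B x *\<^sub>R (a - u x))) \<le>
      (\<integral>\<^sup>+x. ennreal (norm (indicator B x *\<^sub>R (a - u x))) \<partial>lebesgue)"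
    by (rule integral_norm_bound_ennreal)
  also have "\<dots> = (\<integral>\<^sup>+x\<in>B. ennreal \<bar>a - u x\<bar> \<partial>lebesgue)"
    by (intro nn_integral_cong) (simp add: indicator_def)
  finally show ?thesis
    using B(3) eq unfolding set_lebesgue_integral_def by (simp add: abs_mult)
qed

text \<open>A version of Jensen's inequality with a superfluous factor 2, which comes from
  \<open>t \<le> J + J\<^bsup>1-p\<^esup> t\<^bsup>p\<^esup>\<close>.\<close>

lemma nn_integral_le_power_mean:
  assumes f[measurable]: "f \<in> borel_measurable M" and B[measurable]: "B \<in> sets M"
    and fin: "emeasure M B \<noteq> \<infinity>" and nonneg: "\<And>x. 0 \<le> f x" and p: "1 \<le> p" and J: "0 \<le> J"
    and le: "(\<integral>\<^sup>+x\<in>B. ennreal (f x powr p) \<partial>M) \<le> ennreal (measure M B * J powr p)"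
  shows "(\<integral>\<^sup>+x\<in>B. ennreal (f x) \<partial>M) \<le> ennreal (2 * measure M B * J)"
proof (cases "J = 0")
  \<comment> \<open>The splitting with \<open>J powr (1 - p)\<close> is meaningless at
    \<open>J = 0\<close>; there \<open>f\<close> vanishes almost everywhere on
    \<open>B\<close>.\<close>
  case True
  then have "(\<integral>\<^sup>+x\<in>B. ennreal (f x powr p) \<partial>M) = 0"
    using le p by simp
  then have "AE x in M. ennreal (f x powr p) * indicator B x = 0"
    by (subst (asm) nn_integral_0_iff_AE) auto
  then have "AE x in M. ennreal (f x) * indicator B x = 0"
    by eventually_elim (auto simp: indicator_def)
  then have "(\<integral>\<^sup>+x\<in>B. ennreal (f x) \<partial>M) = 0"
    by (subst nn_integral_0_iff_AE) auto
  then show ?thesis by simp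
next
  case False
  then have J: "0 < J" using J by simp
  have *: "f x \<le> J + J powr (1 - p) * f x powr p" for x
  proof (cases "f x \<le> J")
    case False
    have "J powr (1 - p) * f x powr p = (f x / J) powr (p - 1) * f x"
      using J False nonneg[of x] by (simp add: powr_divide powr_diff)
    moreover have "1 \<le> (f x / J) powr (p - 1)"
      using J False p by (intro ge_one_powr_ge_zero) auto
    ultimately show ?thesis
      using nonneg[of x] J mult_right_mono[of 1 "(f x / J) powr (p - 1)" "f x"] by simp
  qed (use J in \<open>simp add: add_increasing2\<close>)
  have "(\<integral>\<^sup>+x\<in>B. ennreal (f x) \<partial>M) \<le>
      (\<integral>\<^sup>+x. ennreal J * indicator B x + ennreal (J powr (1 - p)) * (ennreal (f x powr p) * indicator B x) \<partial>M)"
  proof (rule nn_integral_mono)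
    fix x
    show "ennreal (f x) * indicator B x \<le> ennreal J * indicator B x + ennreal (J powr (1 - p)) * (ennreal (f x powr p) * indicator B x)"
      using *[of x] J by (auto simp: indicator_def ennreal_mult[symmetric] ennreal_plus[symmetric] simp del: ennreal_plus intro!: ennreal_leI)
  qed
  also have "\<dots> = ennreal J * emeasure M B + ennreal (J powr (1 - p)) * (\<integral>\<^sup>+x\<in>B. ennreal (f x powr p) \<partial>M)"
    by (simp add: nn_integral_add nn_integral_cmult)
  also have "\<dots> \<le> ennreal J * ennreal (measure M B) + ennreal (J powr (1 - p)) * ennreal (measure M B * J powr p)"
    using le fin by (intro add_mono mult_left_mono) (auto simp: emeasure_eq_ennreal_measure)
  also have "\<dots> = ennreal (J * measure M B + J powr (1 - p) * (measure M B * J powr p))"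
    using J by (simp add: ennreal_mult[symmetric] ennreal_plus[symmetric] del: ennreal_plus)
  also have "J * measure M B + J powr (1 - p) * (measure M B * J powr p) = 2 * measure M B * J"
    using J by (simp add: powr_diff)
  finally show ?thesis .
qed

text \<open>At the points where the inner integral is finite this replaces Lebesgue's differentiation theorem.\<close>

lemma average_oscillation_le:
  fixes u :: "'a::euclidean_space \<Rightarrow> real"
  assumes u[measurable]: "u \<in> borel_measurable lebesgue" and p: "1 < p" and e: "0 < e" and r: "0 < r"
    and D: "ball w r \<subseteq> ball y D" and S: "ball w r \<subseteq> S"
    and int: "set_integrable lebesgue (ball w r) u" and h: "0 \<le> h"
    and le: "(\<integral>\<^sup>+z\<in>S. ennreal (\<bar>u y - u z\<bar> powr p / dist y z powr e) \<partial>lebesgue) \<le> ennreal (h powr p)"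
  shows "\<bar>u y - set_average u (ball w r)\<bar> \<le>
    2 * (D powr e / (unit_ball_vol DIM('a) * r ^ DIM('a))) powr (1 / p) * h"
proof -
  let ?m = "unit_ball_vol DIM('a) * r ^ DIM('a)"
  \<comment> \<open>Chosen so that the measure of the ball times \<open>J powr p\<close> equals
    \<open>D powr e * h powr p\<close>, the bound obtained below for the integral of the
    \<open>p\<close>-th power.\<close>
  define J where "J = (D powr e / ?m) powr (1 / p) * h"
  have m: "0 < ?m" using r by simp
  have J0: "0 \<le> J" using h by (simp add: J_def)
  have "w \<in> ball w r" using r by simp
  then have "w \<in> ball y D" using D by blast
  then have D0: "0 < D" by (metis dist_not_less_zero le_less_trans mem_ball not_le less_le_trans zero_le_dist)
  have mJ: "?m * J powr p = D powr e * h powr p"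
  proof -
    have "J powr p = D powr e / ?m * h powr p"
      using m p h D0 by (simp add: J_def powr_mult powr_powr)
    moreover have "M * (X / M * Y) = X * Y" if "0 < M" for M X Y :: real
      using that by simp
    ultimately show ?thesis using m by metis
  qed
  have [measurable]: "(\<lambda>z::'a. dist y z) \<in> borel_measurable lebesgue"
    by (rule measurable_completion) simp
  have "(\<integral>\<^sup>+z\<in>ball w r. ennreal (\<bar>u y - u z\<bar> powr p) \<partial>lebesgue) \<le>
      (\<integral>\<^sup>+z. ennreal (D powr e) * (ennreal (\<bar>u y - u z\<bar> powr p / dist y z powr e) * indicator (ball w r) z) \<partial>lebesgue)"
  proof (rule nn_integral_mono)
    fix z
    \<comment> \<open>Points of the ball are closer than \<open>D\<close> to \<open>y\<close>, so
      the singular weight can be inserted at the cost of \<open>D powr e\<close>. At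
      \<open>z = y\<close> the left side is 0.\<close>
    have "\<bar>u y - u z\<bar> powr p \<le> D powr e * (\<bar>u y - u z\<bar> powr p / dist y z powr e)" if "z \<in> ball w r"
    proof (cases "y = z")
      case False
      have "dist y z powr e \<le> D powr e"
        using that D e by (intro powr_mono2) auto
      then have "\<bar>u y - u z\<bar> powr p * dist y z powr e \<le> \<bar>u y - u z\<bar> powr p * D powr e"
        by (intro mult_left_mono) auto
      then show ?thesis using False by (simp add: field_simps)
    qed (use p in simp)
    then show "ennreal (\<bar>u y - u z\<bar> powr p) * indicator (ball w r) z \<le>
      ennreal (D powr e) * (ennreal (\<bar>u y - u z\<bar> powr p / dist y z powr e) * indicator (ball w r) z)"
      by (auto simp: indicator_def ennreal_mult[symmetric] intro!: ennreal_leI)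
  qed
  also have "\<dots> = ennreal (D powr e) * (\<integral>\<^sup>+z\<in>ball w r. ennreal (\<bar>u y - u z\<bar> powr p / dist y z powr e) \<partial>lebesgue)"
    by (rule nn_integral_cmult) measurable
  also have "\<dots> \<le> ennreal (D powr e) * (\<integral>\<^sup>+z\<in>S. ennreal (\<bar>u y - u z\<bar> powr p / dist y z powr e) \<partial>lebesgue)"
    using S by (intro mult_left_mono nn_integral_mono) (auto simp: indicator_def)
  also have "\<dots> \<le> ennreal (D powr e) * ennreal (h powr p)"
    by (intro mult_left_mono le) simp
  also have "\<dots> = ennreal (measure lebesgue (ball w r) * J powr p)"
    using mJ r by (simp add: measure_lebesgue_ball ennreal_mult[symmetric] del: measure_completion)
  finally have "(\<integral>\<^sup>+z\<in>ball w r. ennreal \<bar>u y - u z\<bar> \<partial>lebesgue) \<le> ennreal (2 * measure lebesgue (ball w r) * J)"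
    using p J0 r by (intro nn_integral_le_power_mean) (auto simp: emeasure_lebesgue_ball simp del: emeasure_completion measure_completion)
  then have "ennreal (\<bar>u y - set_average u (ball w r)\<bar> * ?m) \<le> ennreal (2 * ?m * J)"
    using set_average_deviation[OF _ _ _ int, of "u y"] r m
    by (auto simp: emeasure_lebesgue_ball measure_lebesgue_ball simp del: emeasure_completion measure_completion)
  then have "\<bar>u y - set_average u (ball w r)\<bar> * ?m \<le> 2 * J * ?m"
    using J0 m by (simp add: ennreal_le_iff mult_ac)
  from mult_right_le_imp_le[OF this m] show ?thesis
    by (simp add: J_def mult.assoc)
qed

text \<open>By \<open>average_oscillation_le\<close> every \<open>y\<close> in
  \<open>ball w r\<close> compares \<open>u y\<close> with the average over
  \<open>ball w' r'\<close>, at the price of a multiple of \<open>g y\<close>. Averaging over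
  \<open>y\<close> replaces \<open>g y\<close> by a bound \<open>b\<close> for its mean, left
  abstract so that any estimate of that mean can be inserted.\<close>

lemma average_difference_le:
  fixes u g :: "'a::euclidean_space \<Rightarrow> real"
  assumes u[measurable]: "u \<in> borel_measurable lebesgue" and g[measurable]: "g \<in> borel_measurable lebesgue"
    and p: "1 < p" and e: "0 < e" and r: "0 < r" "0 < r'"
    and sub: "\<And>y. y \<in> ball w r \<Longrightarrow> ball w' r' \<subseteq> ball y D \<inter> S y"
    and int: "set_integrable lebesgue (ball w r) u" "set_integrable lebesgue (ball w' r') u"
    and g0: "\<And>y. 0 \<le> g y"
    and le: "AE y in lebesgue. y \<in> ball w r \<longrightarrow>
       (\<integral>\<^sup>+z\<in>S y. ennreal (\<bar>u y - u z\<bar> powr p / dist y z powr e) \<partial>lebesgue) \<le> ennreal (g y powr p)"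
    and b: "(\<integral>\<^sup>+y\<in>ball w r. ennreal (g y) \<partial>lebesgue) \<le> ennreal (b * measure lebesgue (ball w r))" "0 \<le> b"
  shows "\<bar>set_average u (ball w' r') - set_average u (ball w r)\<bar> \<le>
    2 * (D powr e / (unit_ball_vol DIM('a) * r' ^ DIM('a))) powr (1 / p) * b"
proof -
  let ?K = "2 * (D powr e / (unit_ball_vol DIM('a) * r' ^ DIM('a))) powr (1 / p)"
  let ?a = "set_average u (ball w' r')"
  have m: "0 < measure lebesgue (ball w r)"
    using r by (simp add: measure_lebesgue_ball del: measure_completion)
  have "ennreal (\<bar>?a - set_average u (ball w r)\<bar> * measure lebesgue (ball w r)) \<le> (\<integral>\<^sup>+y\<in>ball w r. ennreal \<bar>?a - u y\<bar> \<partial>lebesgue)"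
    using r m by (intro set_average_deviation int)
      (auto simp: emeasure_lebesgue_ball simp del: emeasure_completion measure_completion)
  also have "\<dots> \<le> (\<integral>\<^sup>+y. ennreal ?K * (ennreal (g y) * indicator (ball w r) y) \<partial>lebesgue)"
  proof (rule nn_integral_mono_AE, use le in eventually_elim)
    fix y assume *: "y \<in> ball w r \<longrightarrow>
       (\<integral>\<^sup>+z\<in>S y. ennreal (\<bar>u y - u z\<bar> powr p / dist y z powr e) \<partial>lebesgue) \<le> ennreal (g y powr p)"
    show "ennreal \<bar>?a - u y\<bar> * indicator (ball w r) y \<le> ennreal ?K * (ennreal (g y) * indicator (ball w r) y)"
    proof (cases "y \<in> ball w r")
      case True
      have "\<bar>u y - ?a\<bar> \<le> ?K * g y"
        by (rule average_oscillation_le[OF u p e r(2) _ _ int(2) g0]) (use sub[OF True] * True in auto)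
      then show ?thesis
        using True g0[of y] by (simp add: abs_minus_commute ennreal_mult[symmetric] ennreal_leI)
    qed simp
  qed
  also have "\<dots> = ennreal ?K * (\<integral>\<^sup>+y\<in>ball w r. ennreal (g y) \<partial>lebesgue)"
    by (rule nn_integral_cmult) measurable
  also have "\<dots> \<le> ennreal ?K * ennreal (b * measure lebesgue (ball w r))"
    by (intro mult_left_mono b) simp
  also have "\<dots> = ennreal (?K * b * measure lebesgue (ball w r))"
    using b(2) by (simp add: ennreal_mult[symmetric] mult.assoc del: measure_completion)
  finally show ?thesis
    using m b(2) by (subst (asm) ennreal_le_iff) (auto simp del: measure_completion)
qed

section \<open>Hedberg's inequality\<close>

text \<open>The terms that survive form a decreasing geometric series starting at or below
  \<open>Y\<close>. Carrying \<open>min a Y\<close> rather than \<open>Y\<close> lets the induction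
  absorb the first term: if \<open>a\<close> is kept, the remainder is bounded through
  \<open>a * b\<close>.\<close>

lemma sum_geometric_below_le:
  fixes a b Y :: real
  assumes "0 < b" "b < 1" "0 \<le> a" "0 \<le> Y"
  shows "(\<Sum>i<N. if a * b ^ i \<le> Y then a * b ^ i else 0) \<le> min a Y / (1 - b)"
  using \<open>0 \<le> a\<close>
proof (induction N arbitrary: a)
  case 0
  then show ?case using assms by simp
next
  case (Suc N)
  let ?S = "\<Sum>i<N. if (a * b) * b ^ i \<le> Y then (a * b) * b ^ i else 0"
  have IH: "?S \<le> min (a * b) Y / (1 - b)"
    using Suc assms by (intro Suc.IH) simp
  have "(\<Sum>i<Suc N. if a * b ^ i \<le> Y then a * b ^ i else 0) = (if a \<le> Y then a else 0) + ?S"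
    by (simp only: sum.lessThan_Suc_shift power_Suc power_0 mult_1_right mult.assoc)
  also have "\<dots> \<le> min a Y / (1 - b)"
  proof (cases "a \<le> Y")
    case True
    have "?S \<le> a * b / (1 - b)"
      using IH assms by (smt (verit) divide_right_mono)
    moreover have "a + a * b / (1 - b) = a / (1 - b)"
      using assms by (simp add: field_simps)
    ultimately show ?thesis using True by simp
  next
    case False
    have "?S \<le> Y / (1 - b)"
      using IH assms by (smt (verit) divide_right_mono)
    then show ?thesis using False by simp
  qed
  finally show ?case .
qed

text \<open>Read backwards, the progression decreases with ratio \<open>1 / b\<close>, and the
  previous lemma applies.\<close>

lemma sum_geometric_above_le:
  fixes a b Y :: real
  assumes b: "1 < b" and "0 \<le> a" "0 \<le> Y"
  shows "(\<Sum>i<N. if a * b ^ i \<le> Y then a * b ^ i else 0) \<le> Y / (1 - 1 / b)"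
proof -
  let ?f = "\<lambda>t. if t \<le> Y then t else 0"
  have "(\<Sum>i<N. ?f (a * b ^ i)) = (\<Sum>i<N. ?f (a * b ^ (N - Suc i)))"
    by (rule sum.nat_diff_reindex[symmetric])
  also have "\<dots> = (\<Sum>i<N. ?f (a * b ^ (N - 1) * (1 / b) ^ i))"
  proof (rule sum.cong[OF refl])
    fix i assume "i \<in> {..<N}"
    then have "b ^ (N - 1) = b ^ (N - Suc i) * b ^ i"
      by (simp add: power_add[symmetric])
    then have "a * b ^ (N - Suc i) = a * b ^ (N - 1) * (1 / b) ^ i"
      using b by (simp add: power_divide)
    then show "?f (a * b ^ (N - Suc i)) = ?f (a * b ^ (N - 1) * (1 / b) ^ i)" by (simp only:)
  qed
  also have "\<dots> \<le> min (a * b ^ (N - 1)) Y / (1 - 1 / b)"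
    using assms by (intro sum_geometric_below_le) auto
  also have "\<dots> \<le> Y / (1 - 1 / b)"
    using b by (intro divide_right_mono) auto
  finally show ?thesis .
qed

text \<open>Hedberg's splitting at the scale \<open>\<sigma>\<^bsup>-1/\<beta>\<^esup>\<close>, where the two terms of the minimum agree.\<close>

lemma sum_min_powr_le:
  fixes c \<alpha> \<delta> \<beta> \<theta> :: real
  assumes c: "0 < c" and \<alpha>: "0 < \<alpha>" "\<alpha> < 1" and \<delta>: "0 < \<delta>" "\<delta> < \<beta>" and \<theta>: "1 - \<delta> / \<beta> \<le> \<theta>" "\<theta> \<le> 1"
  obtains K where "0 < K" "\<And>N \<sigma>. 0 < \<sigma> \<Longrightarrow>
    (\<Sum>i<N. (c * \<alpha> ^ i) powr \<delta> * min \<sigma> ((c * \<alpha> ^ i) powr (- \<beta>))) \<le> K * \<sigma> powr \<theta>"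
proof -
  \<comment> \<open>The ratios of the progressions \<open>t powr \<delta>\<close> and
    \<open>t powr (\<delta> - \<beta>)\<close> for \<open>t = c * \<alpha> ^ i\<close>. The first
    decreases and the second increases, since \<open>\<delta> < \<beta>\<close>.\<close>
  define \<mu> where "\<mu> = \<alpha> powr \<delta>"
  define \<rho> where "\<rho> = \<alpha> powr (\<delta> - \<beta>)"
  define \<theta>' where "\<theta>' = 1 - \<delta> / \<beta>"
  have \<mu>: "0 < \<mu>" "\<mu> < 1"
    using \<alpha> \<delta> powr_less_mono2[of \<delta> \<alpha> 1] by (auto simp: \<mu>_def)
  have \<rho>: "1 < \<rho>"
    using \<alpha> \<delta> powr_less_mono2_neg[of "\<delta> - \<beta>" \<alpha> 1] by (simp add: \<rho>_def)
  have p\<mu>: "(c * \<alpha> ^ i) powr \<delta> = c powr \<delta> * \<mu> ^ i" for i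
    using c \<alpha> by (simp add: \<mu>_def powr_mult powr_powr powr_realpow[symmetric] mult.commute)
  have p\<rho>: "(c * \<alpha> ^ i) powr (\<delta> - \<beta>) = c powr (\<delta> - \<beta>) * \<rho> ^ i" for i
    using c \<alpha> by (simp add: \<rho>_def powr_mult powr_powr powr_realpow[symmetric] mult.commute)
  define K1 where "K1 = 1 / (1 - \<mu>) + 1 / (1 - 1 / \<rho>)"
  define K2 where "K2 = c powr \<delta> / (1 - \<mu>)"
  have K: "0 < K1" "0 < K2"
    using \<mu> \<rho> c by (auto simp: K1_def K2_def add_pos_pos)
  show thesis
  proof (rule that[of "K1 + K2"])
    show "0 < K1 + K2" using K by simp
    fix N and \<sigma> :: real assume \<sigma>: "0 < \<sigma>"
    let ?t = "\<lambda>i. c * \<alpha> ^ i"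
    let ?S = "\<Sum>i<N. ?t i powr \<delta> * min \<sigma> (?t i powr (- \<beta>))"
    have t: "0 < ?t i" for i using c \<alpha> by simp
    have S1: "?S \<le> K1 * \<sigma> powr \<theta>'"
    proof -
      define T where "T = \<sigma> powr (- 1 / \<beta>)"
      define Y where "Y = \<sigma> powr \<theta>'"
      have T: "0 < T" and Y: "0 < Y" using \<sigma> by (auto simp: T_def Y_def)
      have Y1: "T powr \<delta> * \<sigma> = Y"
      proof -
        have "T powr \<delta> * \<sigma> = \<sigma> powr (- \<delta> / \<beta>) * \<sigma> powr 1"
          using \<sigma> by (simp add: T_def powr_powr)
        also have "\<dots> = Y"
          unfolding powr_add[symmetric] by (simp add: Y_def \<theta>'_def)
        finally show ?thesis .
      qed
      have Y2: "T powr (\<delta> - \<beta>) = Y"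
        using \<delta> by (simp add: T_def Y_def \<theta>'_def powr_powr diff_divide_distrib)
      let ?y = "\<lambda>i. \<sigma> * c powr \<delta> * \<mu> ^ i" and ?z = "\<lambda>i. c powr (\<delta> - \<beta>) * \<rho> ^ i"
      \<comment> \<open>\<open>Y\<close> is the common value of
        \<open>t powr \<delta> * \<sigma>\<close> and \<open>t powr (\<delta> - \<beta>)\<close> at
        \<open>t = T\<close>. Below \<open>T\<close> the former is at most \<open>Y\<close>, above
        \<open>T\<close> the latter, so each term of \<open>?S\<close> is dominated by a surviving
        term of one of the two progressions.\<close>
      have "?S \<le> (\<Sum>i<N. (if ?y i \<le> Y then ?y i else 0) + (if ?z i \<le> Y then ?z i else 0))"
      proof (rule sum_mono)
        fix i
        have y: "?t i powr \<delta> * \<sigma> = ?y i" by (simp add: p\<mu>)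
        have z: "?t i powr \<delta> * ?t i powr (- \<beta>) = ?z i"
          unfolding powr_add[symmetric] using p\<rho>[of i] by simp
        have le: "?t i powr \<delta> * min \<sigma> (?t i powr (- \<beta>)) \<le> ?y i" "?t i powr \<delta> * min \<sigma> (?t i powr (- \<beta>)) \<le> ?z i"
          unfolding y[symmetric] z[symmetric] by (intro mult_left_mono; simp)+
        have pos: "0 \<le> ?y i" "0 \<le> ?z i" using \<sigma> \<mu> \<rho> by auto
        show "?t i powr \<delta> * min \<sigma> (?t i powr (- \<beta>)) \<le> (if ?y i \<le> Y then ?y i else 0) + (if ?z i \<le> Y then ?z i else 0)"
        proof (cases "?t i \<le> T")
          case True
          have "?t i powr \<delta> * \<sigma> \<le> Y"
            unfolding Y1[symmetric] using True \<delta> \<sigma> t[of i] by (intro mult_right_mono powr_mono2) auto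
          then have "?y i \<le> Y" using y by simp
          then show ?thesis using le pos by simp
        next
          case False
          have "?t i powr (\<delta> - \<beta>) \<le> Y"
            unfolding Y2[symmetric] using False \<delta> T by (intro powr_mono2') auto
          then have "?z i \<le> Y" using p\<rho>[of i] by simp
          then show ?thesis using le pos by simp
        qed
      qed
      also have "\<dots> = (\<Sum>i<N. if ?y i \<le> Y then ?y i else 0) + (\<Sum>i<N. if ?z i \<le> Y then ?z i else 0)"
        by (rule sum.distrib)
      also have "\<dots> \<le> min (\<sigma> * c powr \<delta>) Y / (1 - \<mu>) + Y / (1 - 1 / \<rho>)"
        using \<mu> \<rho> \<sigma> Y by (intro add_mono sum_geometric_below_le sum_geometric_above_le) auto
      also have "\<dots> \<le> Y / (1 - \<mu>) + Y / (1 - 1 / \<rho>)"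
        using \<mu> \<rho> by (intro add_mono divide_right_mono) auto
      also have "\<dots> = K1 * Y" by (simp add: K1_def distrib_right)
      finally show ?thesis by (simp add: Y_def)
    qed
    have S2: "?S \<le> K2 * \<sigma>"
    proof -
      have "?S \<le> (\<Sum>i<N. \<sigma> * c powr \<delta> * \<mu> ^ i)"
      proof (rule sum_mono)
        fix i
        have "?t i powr \<delta> * min \<sigma> (?t i powr (- \<beta>)) \<le> ?t i powr \<delta> * \<sigma>"
          by (intro mult_left_mono) auto
        then show "?t i powr \<delta> * min \<sigma> (?t i powr (- \<beta>)) \<le> \<sigma> * c powr \<delta> * \<mu> ^ i"
          by (simp add: p\<mu> mult_ac)
      qed
      also have "\<dots> = \<sigma> * c powr \<delta> * (\<Sum>i<N. \<mu> ^ i)"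
        by (simp add: sum_distrib_left)
      also have "\<dots> \<le> \<sigma> * c powr \<delta> * (1 / (1 - \<mu>))"
        using \<mu> \<sigma> by (intro mult_left_mono) (auto simp: sum_gp_strict divide_right_mono)
      finally show ?thesis by (simp add: K2_def mult.commute)
    qed
    have pos: "0 \<le> \<sigma> powr \<theta>" by simp
    \<comment> \<open>For \<open>\<sigma> \<le> 1\<close> the linear bound \<open>S2\<close>
      suffices because \<open>\<theta> \<le> 1\<close>; for larger \<open>\<sigma>\<close> the bound
      \<open>S1\<close> with the critical exponent does, because
      \<open>\<theta>' \<le> \<theta>\<close>.\<close>
    show "?S \<le> (K1 + K2) * \<sigma> powr \<theta>"
    proof (cases "\<sigma> \<le> 1")
      case True
      have "\<sigma> powr 1 \<le> \<sigma> powr \<theta>"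
        using True \<sigma> \<theta> by (intro powr_mono') auto
      then have "K2 * \<sigma> \<le> K2 * \<sigma> powr \<theta>" using K \<sigma> by simp
      moreover have "0 \<le> K1 * \<sigma> powr \<theta>" using K by simp
      ultimately show ?thesis using S2 by (simp add: distrib_right)
    next
      case False
      have "\<sigma> powr \<theta>' \<le> \<sigma> powr \<theta>"
        using False \<theta> by (intro powr_mono) (auto simp: \<theta>'_def)
      then have "K1 * \<sigma> powr \<theta>' \<le> K1 * \<sigma> powr \<theta>" using K by simp
      moreover have "0 \<le> K2 * \<sigma> powr \<theta>" using K by simp
      ultimately show ?thesis using S1 by (simp add: distrib_right)
    qed
  qed
qed

text \<open>This replaces \<open>v \<le> K A\<^bsup>1-p/q\<^esup> (Mg)\<^bsup>p/q\<^esup>\<close> for the maximal function \<open>M\<close>, which may take the value \<open>\<infinity>\<close>.\<close>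

lemma nn_integral_powr_le_of_max_level:
  fixes g v :: "'a::euclidean_space \<Rightarrow> real"
  assumes g: "g \<in> borel_measurable lebesgue" "\<And>x. 0 \<le> g x" and p: "1 < p" "p \<le> q"
    and A: "0 < A" and K: "0 < K" and v0: "\<And>x. 0 \<le> v x"
    and le: "(\<integral>\<^sup>+x. ennreal (g x powr p) \<partial>lebesgue) \<le> ennreal (A powr p)"
    and v: "AE x in lebesgue. x \<in> G \<longrightarrow> (\<forall>s>0. x \<notin> max_level g R s \<longrightarrow> v x \<le> K * A * (s / A) powr (p / q))"
  shows "(\<integral>\<^sup>+x\<in>G. ennreal (v x powr q) \<partial>lebesgue) \<le>
    ennreal (K powr q * (5 ^ DIM('a) * 2 powr p * p / (p - 1)) * A powr q)"
proof -
  let ?C = "5 ^ DIM('a) * 2 powr p * p / (p - 1)"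
  let ?L = "\<lambda>x. \<integral>\<^sup>+s. ennreal (p * s powr (p - 1)) * indicator {0<..} s * indicator (max_level g R s) x \<partial>lborel"
  have "(\<integral>\<^sup>+x\<in>G. ennreal (v x powr q) \<partial>lebesgue) \<le> (\<integral>\<^sup>+x. ennreal (K powr q * A powr (q - p)) * ?L x \<partial>lebesgue)"
  proof (rule nn_integral_mono_AE, use v in eventually_elim)
    fix x assume v: "x \<in> G \<longrightarrow> (\<forall>s>0. x \<notin> max_level g R s \<longrightarrow> v x \<le> K * A * (s / A) powr (p / q))"
    show "ennreal (v x powr q) * indicator G x \<le> ennreal (K powr q * A powr (q - p)) * ?L x"
    proof (cases "x \<in> G")
      case True
      \<comment> \<open>The level at which the assumed bound
        \<open>K * A * (s / A) powr (p / q)\<close> equals \<open>v x\<close>. At every level below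
        \<open>b\<close> that bound would fail, so \<open>x\<close> lies in all these level sets and
        the inner integral is at least \<open>b powr p\<close>.\<close>
      define b where "b = A * (v x / (K * A)) powr (q / p)"
      have b: "0 \<le> b" using A by (simp add: b_def)
      have bp: "b powr p = A powr (p - q) * v x powr q / K powr q"
        using A K p v0[of x] by (simp add: b_def powr_mult powr_powr powr_divide powr_diff)
      have "ennreal (b powr p) = (\<integral>\<^sup>+s. ennreal (p * s powr (p - 1)) * indicator {0<..<b} s \<partial>lborel)"
        using p b by (intro nn_integral_powr_interval[symmetric]) auto
      also have "\<dots> \<le> ?L x"
      proof (rule nn_integral_mono)
        fix s
        have "x \<in> max_level g R s" if s: "0 < s" "s < b"
        proof (rule ccontr)
          assume "x \<notin> max_level g R s"
          then have "v x \<le> K * A * (s / A) powr (p / q)" using v True s by blast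
          then have "v x / (K * A) \<le> (s / A) powr (p / q)"
            using A K by (simp add: divide_le_eq mult_ac)
          then have "(v x / (K * A)) powr (q / p) \<le> ((s / A) powr (p / q)) powr (q / p)"
            using A K p v0[of x] by (intro powr_mono2) auto
          also have "\<dots> = s / A" using s A p by (simp add: powr_powr)
          finally have "b \<le> s" using A by (simp add: b_def field_simps)
          then show False using s by simp
        qed
        then show "ennreal (p * s powr (p - 1)) * indicator {0<..<b} s \<le>
          ennreal (p * s powr (p - 1)) * indicator {0<..} s * indicator (max_level g R s) x"
          by (auto simp: indicator_def)
      qed
      finally have "ennreal (K powr q * A powr (q - p)) * ennreal (b powr p) \<le> ennreal (K powr q * A powr (q - p)) * ?L x"
        by (rule mult_left_mono) simp
      moreover have "K powr q * A powr (q - p) * b powr p = v x powr q"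
        using A K by (simp add: bp powr_diff)
      ultimately show ?thesis
        using True by (simp add: ennreal_mult[symmetric])
    qed simp
  qed
  also have "\<dots> \<le> ennreal (K powr q * A powr (q - p)) * (\<integral>\<^sup>+x. ?L x \<partial>lebesgue)"
  proof (rule eq_refl, rule nn_integral_cmult)
    have "(\<lambda>z. ennreal (p * snd z powr (p - 1)) * indicator {0<..} (snd z) * indicator {(x, s). x \<in> max_level g R s} z)
        \<in> borel_measurable ((lebesgue :: 'a measure) \<Otimes>\<^sub>M (lborel :: real measure))"
      using sets_max_level_graph[measurable] snd_borel_lborel[measurable] by measurable
    from lborel.borel_measurable_nn_integral_fst[OF this]
    show "?L \<in> borel_measurable lebesgue" by (simp add: indicator_def)
  qed
  also have "\<dots> \<le> ennreal (K powr q * A powr (q - p)) * (ennreal ?C * ennreal (A powr p))"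
    by (intro mult_left_mono order_trans[OF nn_integral_max_level_le[OF g p(1)]] le) auto
  also have "\<dots> = ennreal (K powr q * A powr (q - p) * (?C * A powr p))"
  proof -
    have "ennreal X * (ennreal Y * ennreal Z) = ennreal (X * (Y * Z))"
      if "0 \<le> X" "0 \<le> Y" "0 \<le> Z" for X Y Z :: real
      using that by (simp add: ennreal_mult)
    then show ?thesis using p by simp
  qed
  also have "K powr q * A powr (q - p) * (?C * A powr p) = K powr q * ?C * A powr q"
    using A by (simp add: powr_diff)
  finally show ?thesis .
qed

section \<open>Chains of balls along John curves\<close>

text \<open>A ball that contains a point of \<open>G\<close> and leaves \<open>G\<close> is
  connected, so it meets the frontier, and it does so at distance less than \<open>r\<close> from
  its centre.\<close>

lemma ball_subset_infdist_frontier: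
  fixes z :: "'a::euclidean_space"
  assumes z: "z \<in> G" and r: "r \<le> infdist z (frontier G)"
  shows "ball z r \<subseteq> G"
proof (rule ccontr)
  assume not: "\<not> ball z r \<subseteq> G"
  then obtain y where "y \<in> ball z r" by blast
  then have "z \<in> ball z r" using le_less_trans[OF zero_le_dist, of z y r] by simp
  then have "ball z r \<inter> frontier G \<noteq> {}"
    using not z by (intro connected_Int_frontier connected_ball) blast+
  then obtain f where f: "f \<in> frontier G" "dist z f < r" by auto
  then show False using infdist_le[OF f(1), of z] r by simp
qed

text \<open>Shows that the constant in \<open>average_oscillation_le\<close>, with \<open>D\<close>
  and the radius both proportional to \<open>t\<close>, is a fixed multiple of
  \<open>t powr \<delta>\<close>: the powers \<open>t ^ n\<close> cancel.\<close>

lemma powr_scaling: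
  fixes a b t w p \<delta> :: real
  assumes "0 < a" "0 < b" "0 < t" "0 < w" "0 < p"
  shows "((a * t) powr (real n + \<delta> * p) / (w * (b * t) ^ n)) powr (1 / p) =
    (a powr (real n + \<delta> * p) / (w * b ^ n)) powr (1 / p) * t powr \<delta>"
proof -
  have "(a * t) powr (real n + \<delta> * p) / (w * (b * t) ^ n) =
      a powr (real n + \<delta> * p) / (w * b ^ n) * t powr (\<delta> * p)"
    using assms by (simp add: powr_mult powr_add powr_realpow power_mult_distrib)
  also have "\<dots> powr (1 / p) = (a powr (real n + \<delta> * p) / (w * b ^ n)) powr (1 / p) * (t powr (\<delta> * p)) powr (1 / p)"
    by (rule powr_mult)
  finally show ?thesis using assms by (simp add: powr_powr)
qed

definition local_energy :: "'a::euclidean_space set \<Rightarrow> real \<Rightarrow> real \<Rightarrow> real \<Rightarrow> ('a \<Rightarrow> real) \<Rightarrow> 'a \<Rightarrow> ennreal" where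
  "local_energy G \<tau> \<delta> p u x = (\<integral>\<^sup>+y\<in>G \<inter> ball x (\<tau> * infdist x (frontier G)).
     ennreal (\<bar>u x - u y\<bar> powr p / dist x y powr (real DIM('a) + \<delta> * p)) \<partial>lebesgue)"

text \<open>Since \<open>x\<close> is outside the level set, the average of \<open>g\<close> over
  \<open>ball x (2 * t)\<close> is at most \<open>s\<close>, and that ball exceeds
  \<open>ball w (\<epsilon> * t)\<close> by a bounded factor in measure. The other bound in the
  minimum is the power mean inequality applied to the \<open>L^p\<close> norm of
  \<open>g\<close>.\<close>

lemma average_le_of_max_level:
  fixes g :: "'a::euclidean_space \<Rightarrow> real"
  assumes g[measurable]: "g \<in> borel_measurable lebesgue" and g0: "\<And>y. 0 \<le> g y" and p: "1 < p" and A: "0 < A" and s: "0 < s"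
    and gA: "(\<integral>\<^sup>+y. ennreal (g y powr p) \<partial>lebesgue) \<le> ennreal (A powr p)"
    and xs: "x \<notin> max_level g R s" and \<epsilon>: "0 < \<epsilon>" and t: "0 < t" "2 * t \<le> R"
    and sub: "ball w (\<epsilon> * t) \<subseteq> ball x (2 * t)"
  shows "(\<integral>\<^sup>+y\<in>ball w (\<epsilon> * t). ennreal (g y) \<partial>lebesgue) \<le>
    ennreal (((2 / \<epsilon>) ^ DIM('a) + 2 * (unit_ball_vol DIM('a) * \<epsilon> ^ DIM('a)) powr (- 1 / p)) *
      min s (A * t powr (- real DIM('a) / p)) * measure lebesgue (ball w (\<epsilon> * t)))"
proof -
  let ?n = "DIM('a)" and ?B = "ball w (\<epsilon> * t)"
  let ?m = "measure lebesgue ?B"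
  let ?I = "\<integral>\<^sup>+y\<in>?B. ennreal (g y) \<partial>lebesgue"
  \<comment> \<open>\<open>k1\<close> is the ratio of the measures of the two balls; the 2 in
    \<open>k2\<close> is the factor lost in \<open>nn_integral_le_power_mean\<close>.\<close>
  define k1 k2 where "k1 = (2 / \<epsilon>) ^ ?n" and "k2 = 2 * (unit_ball_vol ?n * \<epsilon> ^ ?n) powr (- 1 / p)"
  have m: "?m = unit_ball_vol ?n * \<epsilon> ^ ?n * t ^ ?n"
    using \<epsilon> t by (simp add: measure_lebesgue_ball power_mult_distrib del: measure_completion)
  have "?I \<le> (\<integral>\<^sup>+y\<in>ball x (2 * t). ennreal (g y) \<partial>lebesgue)"
    using sub by (intro nn_integral_mono) (auto simp: indicator_def)
  also have "\<dots> \<le> ennreal s * emeasure lebesgue (ball x (2 * t))"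
  proof (rule ccontr)
    assume "\<not> ?thesis"
    then have "ball x (2 * t) \<subseteq> max_level g R s"
      unfolding max_level_def using t
      by (intro Union_upper CollectI exI[of _ x] exI[of _ "2 * t"]) (simp add: not_le)
    moreover have "x \<in> ball x (2 * t)" using t by simp
    ultimately show False using xs by blast
  qed
  also have "\<dots> = ennreal (k1 * s * ?m)"
    using s t \<epsilon> unfolding m
    by (simp add: emeasure_lebesgue_ball ennreal_mult[symmetric] k1_def power_mult_distrib power_divide mult_ac del: emeasure_completion)
  finally have 1: "?I \<le> ennreal (k1 * s * ?m)" .
  \<comment> \<open>Chosen so that \<open>?m * J powr p\<close> is \<open>A powr p\<close>.\<close>
  define J where "J = A * (unit_ball_vol ?n * \<epsilon> ^ ?n * t ^ ?n) powr (- 1 / p)"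
  have mJ: "?m * J powr p = A powr p"
  proof -
    have "V * (A * V powr (- 1 / p)) powr p = A powr p" if "0 < V" for V
    proof -
      have "(V powr (- 1 / p)) powr p = inverse V"
        unfolding powr_powr using that p by (simp add: powr_minus)
      then show ?thesis using that by (simp add: powr_mult)
    qed
    then show ?thesis using \<epsilon> t unfolding m J_def by simp
  qed
  have "(\<integral>\<^sup>+y\<in>?B. ennreal (g y powr p) \<partial>lebesgue) \<le> (\<integral>\<^sup>+y. ennreal (g y powr p) \<partial>lebesgue)"
    by (intro nn_integral_mono) (auto simp: indicator_def)
  also have "\<dots> \<le> ennreal (?m * J powr p)" using gA unfolding mJ .
  finally have "?I \<le> ennreal (2 * ?m * J)"
    using p A g0 t \<epsilon> by (intro nn_integral_le_power_mean) (auto simp: J_def emeasure_lebesgue_ball simp del: measure_completion emeasure_completion)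
  also have "2 * ?m * J = k2 * (A * t powr (- real ?n / p)) * ?m"
  proof -
    have "J = A * ((unit_ball_vol ?n * \<epsilon> ^ ?n) powr (- 1 / p) * t powr (- real ?n / p))"
      using \<epsilon> t by (simp add: J_def powr_mult powr_powr powr_realpow[symmetric])
    then show ?thesis by (simp add: k2_def)
  qed
  finally have 2: "?I \<le> ennreal (k2 * (A * t powr (- real ?n / p)) * ?m)" .
  have k: "0 \<le> k1" "0 \<le> k2" using \<epsilon> by (auto simp: k1_def k2_def)
  have "?I \<le> ennreal ((k1 + k2) * min s (A * t powr (- real ?n / p)) * ?m)"
  proof (cases "s \<le> A * t powr (- real ?n / p)")
    case True
    have "k1 * s * ?m \<le> (k1 + k2) * s * ?m"
      using k s by (intro mult_right_mono) auto
    with 1 True show ?thesis by (simp add: order_trans[OF 1] ennreal_leI min_def del: measure_completion)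
  next
    case False
    have "k2 * (A * t powr (- real ?n / p)) * ?m \<le> (k1 + k2) * (A * t powr (- real ?n / p)) * ?m"
      using k A by (intro mult_right_mono) auto
    with 2 False show ?thesis by (simp add: order_trans[OF 2] ennreal_leI min_def del: measure_completion)
  qed
  then show ?thesis by (simp only: k1_def k2_def)
qed

text \<open>The differences of consecutive averages are summed by telescoping, uniformly in the
  length \<open>N\<close> of the chain. The energy bound at \<open>x\<close> itself compares
  \<open>u x\<close> with the last average up to a multiple of \<open>t powr \<delta>\<close> for
  the last \<open>t\<close>, and this error disappears as \<open>N\<close> grows.\<close>

lemma john_chain_estimate:
  fixes G :: "'a::euclidean_space set" and u g :: "'a \<Rightarrow> real" and \<gamma> :: "real \<Rightarrow> 'a"
  defines "n \<equiv> DIM('a)"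
  assumes u: "u \<in> borel_measurable lebesgue" "set_integrable lebesgue G u"
    and g: "g \<in> borel_measurable lebesgue" "\<And>y. 0 \<le> g y"
    and p: "1 < p" and \<delta>: "0 < \<delta>" and \<tau>: "0 < \<tau>" "\<tau> < 1" and \<kappa>: "0 < \<kappa>" "\<kappa> \<le> 1" and c: "0 < c"
    and A: "0 < A" "(\<integral>\<^sup>+y. ennreal (g y powr p) \<partial>lebesgue) \<le> ennreal (A powr p)"
    and gW: "AE y in lebesgue. y \<in> G \<longrightarrow> local_energy G \<tau> \<delta> p u y \<le> ennreal (g y powr p)"
    and gx: "local_energy G \<tau> \<delta> p u x \<le> ennreal (g x powr p)" "0 < infdist x (frontier G)"
    and s: "0 < s" "x \<notin> max_level g (2 * c) s"
    and \<gamma>0: "\<gamma> 0 = x"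
    and \<gamma>: "\<And>t t'. 0 \<le> t \<Longrightarrow> t \<le> t' \<Longrightarrow> t' \<le> c \<Longrightarrow> dist (\<gamma> t) (\<gamma> t') \<le> t' - t"
    and \<gamma>G: "\<And>t. 0 \<le> t \<Longrightarrow> t \<le> c \<Longrightarrow> \<gamma> t \<in> G"
    and \<gamma>d: "\<And>t. 0 \<le> t \<Longrightarrow> t \<le> c \<Longrightarrow> \<kappa> * t \<le> infdist (\<gamma> t) (frontier G)"
    and \<epsilon>: "\<epsilon> = \<tau> * \<kappa> / 4"
    and K1: "K1 = 2 * ((3 * \<epsilon>) powr (n + \<delta> * p) / (unit_ball_vol n * (\<epsilon> * (1 - \<epsilon>)) ^ n)) powr (1 / p)"
    and K2: "K2 = (2 / \<epsilon>) ^ n + 2 * (unit_ball_vol n * \<epsilon> ^ n) powr (- 1 / p)"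
    and M: "\<And>N. (\<Sum>i<N. (c * (1 - \<epsilon>) ^ i) powr \<delta> * min s (A * (c * (1 - \<epsilon>) ^ i) powr (- real n / p))) \<le> M"
  shows "\<bar>u x - set_average u (ball (\<gamma> c) (\<epsilon> * c))\<bar> \<le> K1 * K2 * M"
proof -
  let ?d = "\<lambda>y. infdist y (frontier G)"
  let ?e = "real n + \<delta> * p"
  let ?t = "\<lambda>i. c * (1 - \<epsilon>) ^ i"
  let ?B = "\<lambda>i. ball (\<gamma> (?t i)) (\<epsilon> * ?t i)"
  let ?S = "\<lambda>y. G \<inter> ball y (\<tau> * ?d y)"
  \<comment> \<open>The choice of \<open>\<epsilon>\<close> has to put the balls inside
    \<open>G\<close>, for which \<open>4 * \<epsilon> \<le> \<kappa>\<close> is ample, and to give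
    \<open>3 * \<epsilon> \<le> \<tau> * (\<kappa> - \<epsilon>)\<close> in the inclusion
    \<open>sub\<close> below.\<close>
  have \<epsilon>0: "0 < \<epsilon>" "\<epsilon> < 1 / 4" "4 * \<epsilon> \<le> \<kappa>"
  proof -
    show "0 < \<epsilon>" using \<tau> \<kappa> by (simp add: \<epsilon>)
    have "\<tau> * \<kappa> \<le> 1 * \<kappa>" using \<tau> \<kappa> by (intro mult_right_mono) auto
    then show "4 * \<epsilon> \<le> \<kappa>" by (simp add: \<epsilon>)
    have "\<tau> * \<kappa> \<le> \<tau>" using \<tau> \<kappa> by (simp add: mult_left_le)
    then have "\<tau> * \<kappa> < 1" using \<tau> by linarith
    then show "\<epsilon> < 1 / 4" by (simp add: \<epsilon>)
  qed
  have e0: "0 < ?e" using \<delta> p by (simp add: add_nonneg_pos)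
  have t: "0 < ?t i" "?t i \<le> c" for i
    using c \<epsilon>0 by (auto simp: mult_le_cancel_left2 power_le_one)
  \<comment> \<open>The parameter drops by exactly the radius of the current ball, so consecutive
    centres are at most one radius apart.\<close>
  have tS: "?t (Suc i) = ?t i - \<epsilon> * ?t i" for i by (simp add: algebra_simps)
  have tS_le: "?t (Suc i) \<le> ?t i" for i
    using tS[of i] mult_pos_pos[OF \<epsilon>0(1) t(1)[of i]] by linarith
  have BG: "?B i \<subseteq> G" for i
  proof (rule ball_subset_infdist_frontier)
    show "\<gamma> (?t i) \<in> G" using t[of i] by (intro \<gamma>G) auto
    have "\<epsilon> * ?t i \<le> \<kappa> * ?t i" using \<epsilon>0 t[of i] by (intro mult_right_mono) auto
    also have "\<dots> \<le> ?d (\<gamma> (?t i))" using t[of i] by (intro \<gamma>d) auto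
    finally show "\<epsilon> * ?t i \<le> ?d (\<gamma> (?t i))" .
  qed
  have Bx: "?B i \<subseteq> ball x (2 * ?t i)" for i
  proof
    fix y assume y: "y \<in> ?B i"
    have "dist x (\<gamma> (?t i)) \<le> ?t i" using \<gamma>[of 0 "?t i"] t[of i] by (simp add: \<gamma>0)
    moreover have "\<epsilon> * ?t i < 1 * ?t i" using \<epsilon>0 t[of i] by (intro mult_strict_right_mono) auto
    ultimately show "y \<in> ball x (2 * ?t i)"
      using y dist_triangle[of x y "\<gamma> (?t i)"] by simp
  qed
  have int: "set_integrable lebesgue (?B i) u" for i
    by (rule set_integrable_subset[OF u(2) _ BG]) simp
  have step: "\<bar>set_average u (?B (Suc i)) - set_average u (?B i)\<bar> \<le>
      K1 * K2 * (?t i powr \<delta> * min s (A * ?t i powr (- real n / p)))" for i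
  proof -
    \<comment> \<open>The 3 counts the distances from \<open>y\<close> to its centre, between the
      two centres, and from the next centre to \<open>z\<close>, each at most
      \<open>\<epsilon> * ?t i\<close>. The distance from \<open>y\<close> to the frontier is at
      least \<open>(\<kappa> - \<epsilon>) * ?t i\<close>, so a ball of this size fits into the
      domain of the inner integral at \<open>y\<close>.\<close>
    have sub: "?B (Suc i) \<subseteq> ball y (3 * \<epsilon> * ?t i) \<inter> ?S y" if y: "y \<in> ?B i" for y
    proof -
      have "dist (\<gamma> (?t (Suc i))) (\<gamma> (?t i)) \<le> ?t i - ?t (Suc i)"
        by (intro \<gamma> tS_le t less_imp_le[OF t(1)])
      also have "\<dots> = \<epsilon> * ?t i" using tS[of i] by linarith
      finally have d1: "dist (\<gamma> (?t (Suc i))) (\<gamma> (?t i)) \<le> \<epsilon> * ?t i" .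
      have r: "\<epsilon> * ?t (Suc i) \<le> \<epsilon> * ?t i"
        by (intro mult_left_mono tS_le less_imp_le[OF \<epsilon>0(1)])
      have 1: "?B (Suc i) \<subseteq> ball y (3 * \<epsilon> * ?t i)"
      proof
        fix z assume "z \<in> ?B (Suc i)"
        then have "dist (\<gamma> (?t (Suc i))) z < \<epsilon> * ?t i" using r unfolding mem_ball by linarith
        moreover have "dist (\<gamma> (?t i)) y < \<epsilon> * ?t i" using y by simp
        ultimately have "dist y z < 3 * (\<epsilon> * ?t i)"
          using d1 dist_triangle[of y z "\<gamma> (?t i)"] dist_triangle[of "\<gamma> (?t i)" z "\<gamma> (?t (Suc i))"]
          by (simp add: dist_commute)
        then show "z \<in> ball y (3 * \<epsilon> * ?t i)" by (simp add: mult.assoc)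
      qed
      have "\<kappa> * ?t i \<le> ?d (\<gamma> (?t i))" using t[of i] by (intro \<gamma>d) auto
      also have "\<dots> \<le> ?d y + dist (\<gamma> (?t i)) y" by (rule infdist_triangle)
      finally have "\<kappa> * ?t i - \<epsilon> * ?t i \<le> ?d y" using y by simp
      then have "\<tau> * (\<kappa> * ?t i - \<epsilon> * ?t i) \<le> \<tau> * ?d y"
        using \<tau> by (intro mult_left_mono) auto
      moreover have "3 * \<epsilon> * ?t i \<le> \<tau> * (\<kappa> * ?t i - \<epsilon> * ?t i)"
      proof -
        have "\<tau> * \<epsilon> \<le> 1 * \<epsilon>" using \<tau> \<epsilon>0 by (intro mult_right_mono) auto
        then have "3 * \<epsilon> \<le> 4 * \<epsilon> - \<tau> * \<epsilon>" by linarith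
        also have "4 * \<epsilon> = \<tau> * \<kappa>" by (simp add: \<epsilon>)
        finally have "3 * \<epsilon> \<le> \<tau> * \<kappa> - \<tau> * \<epsilon>" .
        from mult_right_mono[OF this] have "3 * \<epsilon> * ?t i \<le> (\<tau> * \<kappa> - \<tau> * \<epsilon>) * ?t i"
          using t[of i] by (simp add: less_imp_le)
        also have "\<dots> = \<tau> * (\<kappa> * ?t i - \<epsilon> * ?t i)" by (simp add: algebra_simps)
        finally show ?thesis .
      qed
      ultimately have "ball y (3 * \<epsilon> * ?t i) \<subseteq> ball y (\<tau> * ?d y)" by (intro subset_ball) simp
      with 1 BG[of "Suc i"] show ?thesis by blast
    qed
    let ?b = "K2 * min s (A * ?t i powr (- real n / p))"
    have b0: "0 \<le> ?b" using s A \<epsilon>0 by (auto simp: K2)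
    have "\<bar>set_average u (?B (Suc i)) - set_average u (?B i)\<bar> \<le>
      2 * ((3 * \<epsilon> * ?t i) powr ?e / (unit_ball_vol DIM('a) * (\<epsilon> * ?t (Suc i)) ^ DIM('a))) powr (1 / p) * ?b"
    proof (rule average_difference_le[OF u(1) g(1) p e0 _ _ sub int int g(2) _ _ b0])
      show "0 < \<epsilon> * ?t i" "0 < \<epsilon> * ?t (Suc i)" using \<epsilon>0 t[of i] t[of "Suc i"] by simp_all
      show "AE y in lebesgue. y \<in> ?B i \<longrightarrow>
       (\<integral>\<^sup>+z\<in>?S y. ennreal (\<bar>u y - u z\<bar> powr p / dist y z powr ?e) \<partial>lebesgue) \<le> ennreal (g y powr p)"
        using gW by eventually_elim (use BG[of i] in \<open>auto simp: local_energy_def n_def\<close>)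
      show "(\<integral>\<^sup>+y\<in>?B i. ennreal (g y) \<partial>lebesgue) \<le> ennreal (?b * measure lebesgue (?B i))"
        unfolding K2 n_def using s \<epsilon>0 t[of i] Bx[of i] by (intro average_le_of_max_level[OF g p A(1) _ A(2)]) auto
    qed
    \<comment> \<open>The volume in the denominator is that of the next, smaller ball, whence the
      factor \<open>1 - \<epsilon>\<close> in \<open>K1\<close>.\<close>
    also have "2 * ((3 * \<epsilon> * ?t i) powr ?e / (unit_ball_vol DIM('a) * (\<epsilon> * ?t (Suc i)) ^ DIM('a))) powr (1 / p) = K1 * ?t i powr \<delta>"
    proof -
      have "\<epsilon> * ?t (Suc i) = \<epsilon> * (1 - \<epsilon>) * ?t i" by simp
      then show ?thesis
        unfolding K1 n_def using powr_scaling[of "3 * \<epsilon>" "\<epsilon> * (1 - \<epsilon>)" "?t i" "unit_ball_vol DIM('a)" p "DIM('a)" \<delta>]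
          \<epsilon>0 t[of i] p by (simp only: mult.assoc) simp
    qed
    finally show ?thesis by (simp only: mult_ac)
  qed
  have K0: "0 \<le> K1" "0 \<le> K2" using \<epsilon>0 by (auto simp: K1 K2)
  have tele: "\<bar>set_average u (?B N) - set_average u (?B 0)\<bar> \<le> K1 * K2 * M" for N
  proof -
    have "\<bar>set_average u (?B N) - set_average u (?B 0)\<bar> = \<bar>\<Sum>i<N. set_average u (?B (Suc i)) - set_average u (?B i)\<bar>"
      by (subst sum_lessThan_telescope) simp
    also have "\<dots> \<le> (\<Sum>i<N. K1 * K2 * (?t i powr \<delta> * min s (A * ?t i powr (- real n / p))))"
      by (rule order_trans[OF sum_abs]) (intro sum_mono step)
    also have "\<dots> = K1 * K2 * (\<Sum>i<N. ?t i powr \<delta> * min s (A * ?t i powr (- real n / p)))"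
      by (simp add: sum_distrib_left)
    also have "\<dots> \<le> K1 * K2 * M"
      using K0 M by (intro mult_left_mono) auto
    finally show ?thesis .
  qed
  \<comment> \<open>This constant depends on \<open>g x\<close>, which does no harm because its
    coefficient tends to 0. The comparison with \<open>u x\<close> starts once
    \<open>2 * ?t N < \<tau> * ?d x\<close>, when \<open>ball x (2 * ?t N)\<close> fits into the
    domain of the inner integral at \<open>x\<close>.\<close>
  define K3 where "K3 = 2 * (2 powr ?e / (unit_ball_vol DIM('a) * \<epsilon> ^ DIM('a))) powr (1 / p) * g x"
  have lim: "?t \<longlonglongrightarrow> 0"
    using \<epsilon>0 by (auto intro!: tendsto_eq_intros LIMSEQ_power_zero)
  have "eventually (\<lambda>N. \<bar>u x - set_average u (?B 0)\<bar> \<le> K3 * ?t N powr \<delta> + K1 * K2 * M) sequentially"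
  proof -
    have "eventually (\<lambda>N. ?t N < \<tau> * ?d x / 2) sequentially"
      using \<tau> gx(2) by (intro order_tendstoD(2)[OF lim]) auto
    then show ?thesis
    proof eventually_elim
      fix N assume N: "?t N < \<tau> * ?d x / 2"
      have "\<bar>u x - set_average u (?B N)\<bar> \<le> 2 * ((2 * ?t N) powr ?e / (unit_ball_vol DIM('a) * (\<epsilon> * ?t N) ^ DIM('a))) powr (1 / p) * g x"
      proof (rule average_oscillation_le[OF u(1) p e0 _ Bx _ int g(2)])
        show "0 < \<epsilon> * ?t N" using \<epsilon>0 t[of N] by simp
        have "ball x (2 * ?t N) \<subseteq> ball x (\<tau> * ?d x)" using N by (intro subset_ball) simp
        then show "?B N \<subseteq> ?S x" using BG[of N] Bx[of N] by blast
        show "(\<integral>\<^sup>+z\<in>?S x. ennreal (\<bar>u x - u z\<bar> powr p / dist x z powr ?e) \<partial>lebesgue) \<le> ennreal (g x powr p)"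
          using gx(1) by (simp add: local_energy_def n_def)
      qed
      also have "\<dots> = K3 * ?t N powr \<delta>"
        unfolding K3_def n_def using \<epsilon>0 t[of N] p by (subst powr_scaling) auto
      finally show "\<bar>u x - set_average u (?B 0)\<bar> \<le> K3 * ?t N powr \<delta> + K1 * K2 * M"
        using tele[of N] by linarith
    qed
  qed
  moreover have "(\<lambda>N. K3 * ?t N powr \<delta> + K1 * K2 * M) \<longlonglongrightarrow> K3 * 0 + K1 * K2 * M"
    using \<delta> t by (intro tendsto_intros tendsto_zero_powrI[OF lim tendsto_const]) (auto simp: less_imp_le)
  ultimately have "\<bar>u x - set_average u (?B 0)\<bar> \<le> K3 * 0 + K1 * K2 * M"
    by (intro tendsto_lowerbound[where F = sequentially and f = "\<lambda>N. K3 * ?t N powr \<delta> + K1 * K2 * M"]) auto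
  then show ?thesis by simp
qed

section \<open>The fractional Poincare inequality\<close>

text \<open>The chord is the polygonal sum of the partition \<open>[s, t]\<close>.\<close>

lemma arclength_parametrized_dist_le:
  assumes "arclength_parametrized \<gamma> l" "0 \<le> s" "s \<le> t" "t \<le> l"
  shows "dist (\<gamma> s) (\<gamma> t) \<le> t - s"
proof -
  have "dist (\<gamma> s) (\<gamma> t) \<in> polygonal_sums \<gamma> s t"
    unfolding polygonal_sums_def using assms by (intro CollectI exI[of _ "[s, t]"]) auto
  then have "dist (\<gamma> s) (\<gamma> t) \<le> Sup (polygonal_sums \<gamma> s t)"
    using assms unfolding arclength_parametrized_def by (intro cSup_upper) auto
  then show ?thesis using assms unfolding arclength_parametrized_def by simp
qed

text \<open>As \<open>infdist\<close> to the empty set is 0, the frontier must be nonempty: a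
  bounded nonempty set is not the whole space, and the space is connected.\<close>

lemma infdist_frontier_pos:
  fixes G :: "'a::euclidean_space set"
  assumes "open G" "bounded G" "x \<in> G"
  shows "0 < infdist x (frontier G)"
proof -
  have "frontier G \<noteq> {}"
    using assms not_bounded_UNIV[where 'a = 'a] by (auto simp: frontier_eq_empty)
  moreover have "x \<notin> frontier G"
    using assms by (simp add: frontier_def interior_open)
  ultimately show ?thesis
    by (intro infdist_pos_not_in_closed) (auto simp: frontier_closed)
qed

text \<open>Staying at the centre after reaching it gives all curves the same parameter interval.\<close>

lemma john_domain_curves:
  fixes G :: "'a::euclidean_space set"
  assumes "john_domain G"
  obtains x0 c \<kappa> where "x0 \<in> G" "0 < c" "0 < \<kappa>" "\<kappa> \<le> 1"
    "\<And>x. x \<in> G \<Longrightarrow> \<exists>\<gamma>. \<gamma> 0 = x \<and> \<gamma> c = x0 \<and>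
      (\<forall>t t'. 0 \<le> t \<longrightarrow> t \<le> t' \<longrightarrow> t' \<le> c \<longrightarrow> dist (\<gamma> t) (\<gamma> t') \<le> t' - t) \<and>
      (\<forall>t. 0 \<le> t \<longrightarrow> t \<le> c \<longrightarrow> \<gamma> t \<in> G \<and> \<kappa> * t \<le> infdist (\<gamma> t) (frontier G))"
proof -
  define P where "P x0 c x \<gamma> l \<longleftrightarrow> arclength_parametrized \<gamma> l \<and> \<gamma> ` {0..l} \<subseteq> G \<and>
        \<gamma> 0 = x \<and> \<gamma> l = x0 \<and> l \<le> c \<and> (\<forall>t\<in>{0..l}. infdist (\<gamma> t) (frontier G) \<ge> t / c)"
    for x0 c x and \<gamma> :: "real \<Rightarrow> 'a" and l
  have G: "open G" "bounded G" and "\<exists>x0\<in>G. \<exists>c>0. \<forall>x\<in>G. \<exists>\<gamma> l. P x0 c x \<gamma> l"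
    using assms unfolding john_domain_def P_def by simp_all
  then obtain x0 c where x0: "x0 \<in> G" and c: "0 < c" and curves: "\<And>x. x \<in> G \<Longrightarrow> \<exists>\<gamma> l. P x0 c x \<gamma> l"
    by blast
  define d where "d = infdist x0 (frontier G)"
  have d: "0 < d" unfolding d_def by (rule infdist_frontier_pos[OF G x0])
  \<comment> \<open>\<open>1 / c\<close> serves the John condition up to time \<open>l\<close>;
    \<open>d / c\<close> serves the stationary part, where the distance stays \<open>d\<close> while
    \<open>t\<close> is at most \<open>c\<close>.\<close>
  define \<kappa> where "\<kappa> = min 1 (min (1 / c) (d / c))"
  have \<kappa>: "0 < \<kappa>" "\<kappa> \<le> 1" "\<kappa> \<le> 1 / c" "\<kappa> \<le> d / c" using c d by (auto simp: \<kappa>_def)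
  show thesis
  proof (rule that[OF x0 c \<kappa>(1,2)])
    fix x assume "x \<in> G"
    from curves[OF this] obtain \<gamma> l where \<gamma>: "arclength_parametrized \<gamma> l" "\<gamma> ` {0..l} \<subseteq> G"
      "\<gamma> 0 = x" "\<gamma> l = x0" "l \<le> c" "\<And>t. t \<in> {0..l} \<Longrightarrow> t / c \<le> infdist (\<gamma> t) (frontier G)"
      unfolding P_def by auto
    have l: "0 \<le> l" using \<gamma>(1) by (simp add: arclength_parametrized_def)
    show "\<exists>\<gamma>. \<gamma> 0 = x \<and> \<gamma> c = x0 \<and>
      (\<forall>t t'. 0 \<le> t \<longrightarrow> t \<le> t' \<longrightarrow> t' \<le> c \<longrightarrow> dist (\<gamma> t) (\<gamma> t') \<le> t' - t) \<and>
      (\<forall>t. 0 \<le> t \<longrightarrow> t \<le> c \<longrightarrow> \<gamma> t \<in> G \<and> \<kappa> * t \<le> infdist (\<gamma> t) (frontier G))"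
    proof (intro exI[of _ "\<lambda>t. \<gamma> (min t l)"] conjI allI impI)
      show "\<gamma> (min 0 l) = x" "\<gamma> (min c l) = x0" using \<gamma> l by (simp_all add: min_def)
    next
      fix t t' :: real assume t: "0 \<le> t" "t \<le> t'" "t' \<le> c"
      have "dist (\<gamma> (min t l)) (\<gamma> (min t' l)) \<le> min t' l - min t l"
        using t l by (intro arclength_parametrized_dist_le[OF \<gamma>(1)]) auto
      also have "\<dots> \<le> t' - t" using t by (auto simp: min_def)
      finally show "dist (\<gamma> (min t l)) (\<gamma> (min t' l)) \<le> t' - t" .
    next
      fix t assume t: "0 \<le> t" "t \<le> c"
      show "\<gamma> (min t l) \<in> G" using \<gamma>(2) t l by (auto simp: image_subset_iff)
      show "\<kappa> * t \<le> infdist (\<gamma> (min t l)) (frontier G)"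
      proof (cases "t \<le> l")
        case True
        have "\<kappa> * t \<le> 1 / c * t" using \<kappa> t by (intro mult_right_mono) auto
        also have "\<dots> \<le> infdist (\<gamma> t) (frontier G)" using \<gamma>(6)[of t] True t by simp
        finally show ?thesis using True by simp
      next
        case False
        have "\<kappa> * t \<le> d / c * c" using \<kappa> t d c by (intro mult_mono) auto
        then show ?thesis using False \<gamma>(4) c by (simp add: d_def)
      qed
    qed
  qed
qed

text \<open>A parameter integral of a jointly measurable function. Membership in the ball, which
  varies with \<open>x\<close>, is written as an inequality between measurable functions of the
  pair.\<close>

lemma borel_measurable_local_energy:
  fixes G :: "'a::euclidean_space set"
  assumes u[measurable]: "u \<in> borel_measurable lebesgue" and G[measurable]: "G \<in> sets lebesgue"
  shows "local_energy G \<tau> \<delta> p u \<in> borel_measurable lebesgue"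
proof -
  let ?L = "lebesgue :: 'a measure"
  have [measurable]: "fst \<in> borel_measurable (?L \<Otimes>\<^sub>M ?L)" "snd \<in> borel_measurable (?L \<Otimes>\<^sub>M ?L)"
    by (rule fst_borel_measurable snd_borel_measurable, rule ident_borel_measurable_lebesgue)+
  have "(\<lambda>x::'a. infdist x (frontier G)) \<in> borel_measurable borel"
    by (rule borel_measurable_continuous_onI) (rule continuous_on_infdist[OF continuous_on_id])
  then have [measurable]: "(\<lambda>z::'a \<times> 'a. infdist (fst z) (frontier G)) \<in> borel_measurable (?L \<Otimes>\<^sub>M ?L)"
    by measurable
  have "(\<lambda>z. ennreal (\<bar>u (fst z) - u (snd z)\<bar> powr p / dist (fst z) (snd z) powr (real DIM('a) + \<delta> * p)) *
      (indicator G (snd z) * (if dist (fst z) (snd z) < \<tau> * infdist (fst z) (frontier G) then 1 else 0)))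
      \<in> borel_measurable (?L \<Otimes>\<^sub>M ?L)"
    by measurable
  from lebesgue.borel_measurable_nn_integral_fst[OF this]
  have "(\<lambda>x. \<integral>\<^sup>+y. ennreal (\<bar>u x - u y\<bar> powr p / dist x y powr (real DIM('a) + \<delta> * p)) *
      (indicator G y * (if dist x y < \<tau> * infdist x (frontier G) then 1 else 0)) \<partial>lebesgue) \<in> borel_measurable lebesgue"
    by simp
  also have "(\<lambda>x. \<integral>\<^sup>+y. ennreal (\<bar>u x - u y\<bar> powr p / dist x y powr (real DIM('a) + \<delta> * p)) *
      (indicator G y * (if dist x y < \<tau> * infdist x (frontier G) then 1 else 0)) \<partial>lebesgue) = local_energy G \<tau> \<delta> p u"
    unfolding local_energy_def by (intro ext nn_integral_cong) (auto simp: indicator_def)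
  finally show ?thesis .
qed

text \<open>The constant and the ball are fixed before \<open>u\<close>. An arbitrary positive
  \<open>A\<close> above the norm replaces the norm itself, so that one may divide by it; vanishing
  energy is then reached by letting \<open>A\<close> tend to 0.\<close>

lemma nn_integral_deviation_centre_le:
  fixes G :: "'a::euclidean_space set"
  assumes john: "john_domain G" and \<tau>: "0 < \<tau>" "\<tau> < 1" and \<delta>: "0 < \<delta>"
    and p: "p < real DIM('a) / \<delta>" "1 < p" and q: "p \<le> q" "q \<le> real DIM('a) * p / (real DIM('a) - \<delta> * p)"
  obtains C w r where "0 < C" "\<And>u A. u \<in> borel_measurable lebesgue \<Longrightarrow> set_integrable lebesgue G u \<Longrightarrow> 0 < A \<Longrightarrow>
    (\<integral>\<^sup>+x\<in>G. local_energy G \<tau> \<delta> p u x \<partial>lebesgue) \<le> ennreal (A powr p) \<Longrightarrow>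
    (\<integral>\<^sup>+x\<in>G. ennreal (\<bar>u x - set_average u (ball w r)\<bar> powr q) \<partial>lebesgue) \<le> ennreal (C * A powr q)"
proof -
  let ?n = "real DIM('a)"
  have G: "open G" "bounded G" using john by (auto simp: john_domain_def)
  then have Gs[measurable]: "G \<in> sets lebesgue" by (intro open_in_sets_lebesgue)
  obtain x0 c \<kappa> where x0: "x0 \<in> G" and c: "0 < c" and \<kappa>: "0 < \<kappa>" "\<kappa> \<le> 1" and
    curves: "\<And>x. x \<in> G \<Longrightarrow> \<exists>\<gamma>. \<gamma> 0 = x \<and> \<gamma> c = x0 \<and>
      (\<forall>t t'. 0 \<le> t \<longrightarrow> t \<le> t' \<longrightarrow> t' \<le> c \<longrightarrow> dist (\<gamma> t) (\<gamma> t') \<le> t' - t) \<and>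
      (\<forall>t. 0 \<le> t \<longrightarrow> t \<le> c \<longrightarrow> \<gamma> t \<in> G \<and> \<kappa> * t \<le> infdist (\<gamma> t) (frontier G))"
    using john_domain_curves[OF john] by blast
  define \<epsilon> where "\<epsilon> = \<tau> * \<kappa> / 4"
  define K1 where "K1 = 2 * ((3 * \<epsilon>) powr (?n + \<delta> * p) / (unit_ball_vol ?n * (\<epsilon> * (1 - \<epsilon>)) ^ DIM('a))) powr (1 / p)"
  define K2 where "K2 = (2 / \<epsilon>) ^ DIM('a) + 2 * (unit_ball_vol ?n * \<epsilon> ^ DIM('a)) powr (- 1 / p)"
  have "\<tau> * \<kappa> \<le> \<tau>" using \<tau> \<kappa> by (simp add: mult_left_le)
  then have "\<tau> * \<kappa> < 4" using \<tau> by linarith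
  then have \<epsilon>: "0 < \<epsilon>" "\<epsilon> < 1" using \<tau> \<kappa> by (auto simp: \<epsilon>_def)
  have V: "0 < unit_ball_vol ?n * b ^ DIM('a)" if "0 < b" for b
    using that by simp
  have "unit_ball_vol ?n \<noteq> 0"
    by (rule less_imp_neq[THEN not_sym]) simp
  moreover have "0 < (3 * \<epsilon>) powr (?n + \<delta> * p) / (unit_ball_vol ?n * (\<epsilon> * (1 - \<epsilon>)) ^ DIM('a))"
    using \<epsilon> by (intro divide_pos_pos V) auto
  ultimately have K12: "0 < K1" "0 < K2"
    using \<epsilon> by (auto simp: K1_def K2_def intro!: add_pos_nonneg)
  have \<delta>p: "\<delta> < ?n / p" using p \<delta> by (simp add: field_simps)
  \<comment> \<open>With \<open>\<beta> = n / p\<close> the two conditions of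
    \<open>sum_min_powr_le\<close> on \<open>\<theta> = p / q\<close> are the upper and the lower
    bound on \<open>q\<close>.\<close>
  have \<theta>: "1 - \<delta> / (?n / p) \<le> p / q" "p / q \<le> 1"
  proof -
    have "0 < ?n - \<delta> * p" using \<delta>p p by (simp add: field_simps)
    then have "q * (?n - \<delta> * p) \<le> ?n * p" using q by (simp add: field_simps)
    then show "1 - \<delta> / (?n / p) \<le> p / q" using p q by (simp add: field_simps)
    show "p / q \<le> 1" using p q by simp
  qed
  obtain K0 where K0: "0 < K0" "\<And>N \<sigma>. 0 < \<sigma> \<Longrightarrow>
    (\<Sum>i<N. (c * (1 - \<epsilon>) ^ i) powr \<delta> * min \<sigma> ((c * (1 - \<epsilon>) ^ i) powr (- (?n / p)))) \<le> K0 * \<sigma> powr (p / q)"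
    using sum_min_powr_le[OF c _ _ \<delta> \<delta>p \<theta>, of "1 - \<epsilon>"] \<epsilon> by auto
  define K where "K = K1 * K2 * K0"
  have K: "0 < K" using K0 K12 by (simp add: K_def)
  show thesis
  \<comment> \<open>Every curve ends at \<open>x0\<close> at time \<open>c\<close>, so this ball is
    the first in the chain of every \<open>x\<close>.\<close>
  proof (rule that[of "K powr q * (5 ^ DIM('a) * 2 powr p * p / (p - 1))" x0 "\<epsilon> * c"])
    show "0 < K powr q * (5 ^ DIM('a) * 2 powr p * p / (p - 1))" using K p by simp
    fix u :: "'a \<Rightarrow> real" and A :: real
    assume u[measurable]: "u \<in> borel_measurable lebesgue" and int: "set_integrable lebesgue G u" and A: "0 < A"
      and E: "(\<integral>\<^sup>+x\<in>G. local_energy G \<tau> \<delta> p u x \<partial>lebesgue) \<le> ennreal (A powr p)"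
    let ?W = "local_energy G \<tau> \<delta> p u"
    note borel_measurable_local_energy[OF u Gs, measurable]
    \<comment> \<open>\<open>enn2real\<close> sends \<infinity> to 0, so \<open>g y powr p\<close>
      recovers the energy only where it is finite; by \<open>E\<close> this is almost everywhere on
      \<open>G\<close>.\<close>
    define g where "g y = indicator G y * enn2real (?W y) powr (1 / p)" for y
    have g: "g \<in> borel_measurable lebesgue" "\<And>y. 0 \<le> g y"
      unfolding g_def by measurable
    have "(\<integral>\<^sup>+x\<in>G. ?W x \<partial>lebesgue) \<noteq> \<infinity>" using E by (auto simp: top_unique)
    then have "AE y in lebesgue. ?W y * indicator G y \<noteq> \<infinity>"
      by (intro nn_integral_noteq_infinite) measurable
    then have gW: "AE y in lebesgue. ennreal (g y powr p) = ?W y * indicator G y"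
      by eventually_elim (use p in \<open>auto simp: g_def indicator_def powr_powr less_top\<close>)
    then have "(\<integral>\<^sup>+y. ennreal (g y powr p) \<partial>lebesgue) = (\<integral>\<^sup>+x\<in>G. ?W x \<partial>lebesgue)"
      by (rule nn_integral_cong_AE)
    then have gA: "(\<integral>\<^sup>+y. ennreal (g y powr p) \<partial>lebesgue) \<le> ennreal (A powr p)" using E by simp
    have gW': "AE y in lebesgue. y \<in> G \<longrightarrow> ?W y \<le> ennreal (g y powr p)"
      using gW by eventually_elim auto
    show "(\<integral>\<^sup>+x\<in>G. ennreal (\<bar>u x - set_average u (ball x0 (\<epsilon> * c))\<bar> powr q) \<partial>lebesgue) \<le>
        ennreal (K powr q * (5 ^ DIM('a) * 2 powr p * p / (p - 1)) * A powr q)"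
    proof (rule nn_integral_powr_le_of_max_level[OF g p(2) q(1) A K _ gA])
      \<comment> \<open>The radius bound \<open>2 * c\<close> admits all the balls
        \<open>ball x (2 * t)\<close> with \<open>t \<le> c\<close> that occur along the
        chain.\<close>
      show "AE x in lebesgue. x \<in> G \<longrightarrow> (\<forall>s>0. x \<notin> max_level g (2 * c) s \<longrightarrow>
          \<bar>u x - set_average u (ball x0 (\<epsilon> * c))\<bar> \<le> K * A * (s / A) powr (p / q))"
        using gW'
      proof (eventually_elim, intro impI allI)
        fix x s assume Wx: "x \<in> G \<longrightarrow> ?W x \<le> ennreal (g x powr p)" and x: "x \<in> G"
          and s: "0 < s" "x \<notin> max_level g (2 * c) s"
        from curves[OF x] obtain \<gamma> where \<gamma>: "\<gamma> 0 = x" "\<gamma> c = x0"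
          "\<And>t t'. 0 \<le> t \<Longrightarrow> t \<le> t' \<Longrightarrow> t' \<le> c \<Longrightarrow> dist (\<gamma> t) (\<gamma> t') \<le> t' - t"
          "\<And>t. 0 \<le> t \<Longrightarrow> t \<le> c \<Longrightarrow> \<gamma> t \<in> G"
          "\<And>t. 0 \<le> t \<Longrightarrow> t \<le> c \<Longrightarrow> \<kappa> * t \<le> infdist (\<gamma> t) (frontier G)" by blast
        have "\<bar>u x - set_average u (ball (\<gamma> c) (\<epsilon> * c))\<bar> \<le> K1 * K2 * (A * (K0 * (s / A) powr (p / q)))"
        proof (rule john_chain_estimate[OF u int g p(2) \<delta> \<tau> \<kappa> c A gA gW' _ _ s \<gamma>(1) \<gamma>(3-5) \<epsilon>_def K1_def K2_def])
          show "?W x \<le> ennreal (g x powr p)" using Wx x by blast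
          show "0 < infdist x (frontier G)" by (rule infdist_frontier_pos[OF G x])
          fix N
          \<comment> \<open>Taking out \<open>A\<close> turns the sum into the one of
            \<open>sum_min_powr_le\<close> at \<open>\<sigma> = s / A\<close>.\<close>
          have scale: "min s (A * a) = A * min (s / A) a" for a
            using A by (simp add: min_def field_simps)
          have "(\<Sum>i<N. (c * (1 - \<epsilon>) ^ i) powr \<delta> * min s (A * (c * (1 - \<epsilon>) ^ i) powr (- ?n / p))) =
              A * (\<Sum>i<N. (c * (1 - \<epsilon>) ^ i) powr \<delta> * min (s / A) ((c * (1 - \<epsilon>) ^ i) powr (- (?n / p))))"
            by (simp add: scale sum_distrib_left mult.left_commute)
          also have "\<dots> \<le> A * (K0 * (s / A) powr (p / q))"
            using A s by (intro mult_left_mono K0(2)) auto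
          finally show "(\<Sum>i<N. (c * (1 - \<epsilon>) ^ i) powr \<delta> * min s (A * (c * (1 - \<epsilon>) ^ i) powr (- ?n / p))) \<le> A * (K0 * (s / A) powr (p / q))" .
        qed
        then show "\<bar>u x - set_average u (ball x0 (\<epsilon> * c))\<bar> \<le> K * A * (s / A) powr (p / q)"
          by (simp add: \<gamma>(2) K_def mult_ac)
      qed
    qed simp
  qed
qed

text \<open>The constant \<open>a\<close> differs from the mean by at most the average of
  \<open>\<bar>u - a\<bar>\<close>, which the power mean inequality controls. The rest is
  \<open>(s + t)^q \<le> 2^q (s^q + t^q)\<close> for nonnegative \<open>s\<close> and
  \<open>t\<close>.\<close>

lemma nn_integral_deviation_mean_le:
  fixes G :: "'a::euclidean_space set" and u :: "'a \<Rightarrow> real"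
  assumes u[measurable]: "u \<in> borel_measurable lebesgue" and int: "set_integrable lebesgue G u"
    and G[measurable]: "G \<in> sets lebesgue" and fin: "emeasure lebesgue G \<noteq> \<infinity>" "0 < measure lebesgue G"
    and q: "1 \<le> q" and C: "0 \<le> C"
    and le: "(\<integral>\<^sup>+x\<in>G. ennreal (\<bar>u x - a\<bar> powr q) \<partial>lebesgue) \<le> ennreal C"
  shows "(\<integral>\<^sup>+x\<in>G. ennreal (\<bar>u x - set_average u G\<bar> powr q) \<partial>lebesgue) \<le> ennreal (2 powr q * (1 + 2 powr q) * C)"
proof -
  let ?m = "measure lebesgue G"
  \<comment> \<open>The 2 comes from \<open>nn_integral_le_power_mean\<close> and accounts for the
    inner \<open>2 powr q\<close> in the final constant.\<close>
  define D where "D = 2 * (C / ?m) powr (1 / q)"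
  have D: "?m * D powr q = 2 powr q * C"
    using C fin q by (simp add: D_def powr_mult powr_powr)
  have "(\<integral>\<^sup>+x\<in>G. ennreal \<bar>u x - a\<bar> \<partial>lebesgue) \<le> ennreal (2 * ?m * (C / ?m) powr (1 / q))"
    using fin q C le by (intro nn_integral_le_power_mean) (auto simp: powr_powr)
  then have "(\<integral>\<^sup>+x\<in>G. ennreal \<bar>a - u x\<bar> \<partial>lebesgue) \<le> ennreal (D * ?m)"
    by (simp add: D_def abs_minus_commute mult_ac)
  with set_average_deviation[OF G fin int, of a]
  have "ennreal (\<bar>a - set_average u G\<bar> * ?m) \<le> ennreal (D * ?m)" by (rule order_trans)
  then have aD: "\<bar>a - set_average u G\<bar> \<le> D"
    using fin(2) by (subst (asm) ennreal_le_iff) (auto simp: D_def)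
  have "(\<integral>\<^sup>+x\<in>G. ennreal (\<bar>u x - set_average u G\<bar> powr q) \<partial>lebesgue) \<le>
      (\<integral>\<^sup>+x. ennreal (2 powr q) * (ennreal (\<bar>u x - a\<bar> powr q) * indicator G x + ennreal (D powr q) * indicator G x) \<partial>lebesgue)"
  proof (rule nn_integral_mono)
    fix x
    have "\<bar>u x - set_average u G\<bar> \<le> 2 * max \<bar>u x - a\<bar> D"
      using aD by (auto simp: max_def abs_if split: if_splits)
    then have "\<bar>u x - set_average u G\<bar> powr q \<le> (2 * max \<bar>u x - a\<bar> D) powr q"
      using q by (intro powr_mono2) auto
    also have "\<dots> \<le> 2 powr q * (\<bar>u x - a\<bar> powr q + D powr q)"
      by (auto simp: powr_mult max_def)
    finally show "ennreal (\<bar>u x - set_average u G\<bar> powr q) * indicator G x \<le>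
        ennreal (2 powr q) * (ennreal (\<bar>u x - a\<bar> powr q) * indicator G x + ennreal (D powr q) * indicator G x)"
      by (auto simp: indicator_def ennreal_mult[symmetric] ennreal_plus[symmetric] simp del: ennreal_plus intro!: ennreal_leI)
  qed
  also have "\<dots> = ennreal (2 powr q) * ((\<integral>\<^sup>+x\<in>G. ennreal (\<bar>u x - a\<bar> powr q) \<partial>lebesgue) + ennreal (D powr q) * emeasure lebesgue G)"
    by (simp add: nn_integral_add nn_integral_cmult)
  also have "\<dots> \<le> ennreal (2 powr q) * (ennreal C + ennreal (D powr q) * ennreal ?m)"
    using fin(1) by (intro mult_left_mono add_mono le) (auto simp: emeasure_eq_ennreal_measure)
  also have "\<dots> = ennreal (2 powr q * (C + ?m * D powr q))"
    using C by (simp add: ennreal_mult[symmetric] ennreal_plus[symmetric] mult.commute del: ennreal_plus)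
  also have "2 powr q * (C + ?m * D powr q) = 2 powr q * (1 + 2 powr q) * C"
    unfolding D by (simp add: algebra_simps)
  finally show ?thesis .
qed

text \<open>For infinite \<open>I\<close> the right side of the inequality is infinite and nothing
  is claimed; under \<open>I < \<infinity>\<close> the conversion \<open>enn2real\<close> loses
  nothing.\<close>

theorem theorem4p6:
  fixes G :: "(real ^ 'n) set" and \<tau> \<delta> p q :: real
  assumes "CARD('n) \<ge> 2"
    and "john_domain G"
    and "0 < \<tau>" "\<tau> < 1" "0 < \<delta>" "\<delta> < 1"
    and "p < real CARD('n) / \<delta>"
    and "1 < p" "p \<le> q" "q \<le> real CARD('n) * p / (real CARD('n) - \<delta> * p)"
  shows "\<exists>c::real. \<forall>u :: real ^ 'n \<Rightarrow> real.
     set_borel_measurable lebesgue G u \<longrightarrow>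
     set_integrable lebesgue G (\<lambda>x. \<bar>u x\<bar> powr p) \<longrightarrow>
     (let uG = (LINT x:G|lebesgue. u x) / measure lebesgue G;
          I = (\<integral>\<^sup>+ x\<in>G. (\<integral>\<^sup>+ y\<in>G \<inter> ball x (\<tau> * infdist x (frontier G)).
                 ennreal (\<bar>u x - u y\<bar> powr p / dist x y powr (real CARD('n) + \<delta> * p)) \<partial>lebesgue) \<partial>lebesgue)
      in I < \<infinity> \<longrightarrow>
         (\<integral>\<^sup>+ x\<in>G. ennreal (\<bar>u x - uG\<bar> powr q) \<partial>lebesgue) \<le> ennreal (c * enn2real I powr (q / p)))"
proof -
  let ?n = "real CARD('n)"
  have G: "open G" "bounded G" "G \<noteq> {}"
    using \<open>john_domain G\<close> unfolding john_domain_def by auto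
  have Gs[measurable]: "G \<in> sets lebesgue"
    using G by (intro open_in_sets_lebesgue)
  have fin: "emeasure lebesgue G \<noteq> \<infinity>"
    using emeasure_bounded_finite[OF G(2)] G(1) by simp
  have pos: "0 < measure lebesgue G"
  proof -
    obtain x e where e: "0 < e" "ball x e \<subseteq> G" using G by (metis ex_in_conv open_contains_ball)
    have "0 < measure lebesgue (ball x e)" using e by simp
    also have "\<dots> \<le> measure lebesgue G"
      using e fin by (intro measure_mono_fmeasurable) (auto simp: fmeasurable_def less_top)
    finally show ?thesis .
  qed
  obtain C w r where C: "0 < C" "\<And>u A. u \<in> borel_measurable lebesgue \<Longrightarrow> set_integrable lebesgue G u \<Longrightarrow> 0 < A \<Longrightarrow>
    (\<integral>\<^sup>+x\<in>G. local_energy G \<tau> \<delta> p u x \<partial>lebesgue) \<le> ennreal (A powr p) \<Longrightarrow>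
    (\<integral>\<^sup>+x\<in>G. ennreal (\<bar>u x - set_average u (ball w r)\<bar> powr q) \<partial>lebesgue) \<le> ennreal (C * A powr q)"
    using nn_integral_deviation_centre_le[OF assms(2) assms(3,4,5), of p q] assms by (auto simp del: not_less)
  define C' where "C' = 2 powr q * (1 + 2 powr q) * C"
  have C': "0 < C'" using C(1) by (auto simp: C'_def add_pos_nonneg)
  show ?thesis
  proof (intro exI[of _ C'] allI impI)
    fix u :: "real ^ 'n \<Rightarrow> real"
    assume um: "set_borel_measurable lebesgue G u" and up: "set_integrable lebesgue G (\<lambda>x. \<bar>u x\<bar> powr p)"
    define uG where "uG = (LINT x:G|lebesgue. u x) / measure lebesgue G"
    define I where "I = (\<integral>\<^sup>+ x\<in>G. (\<integral>\<^sup>+ y\<in>G \<inter> ball x (\<tau> * infdist x (frontier G)).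
      ennreal (\<bar>u x - u y\<bar> powr p / dist x y powr (?n + \<delta> * p)) \<partial>lebesgue) \<partial>lebesgue)"
    let ?J = "\<integral>\<^sup>+ x\<in>G. ennreal (\<bar>u x - uG\<bar> powr q) \<partial>lebesgue"
    \<comment> \<open>Extension by zero makes the function measurable on the whole space; all
      integrals involved see only its values on \<open>G\<close>.\<close>
    define v where "v x = indicator G x * u x" for x
    have v: "v \<in> borel_measurable lebesgue"
      using um unfolding set_borel_measurable_def v_def by simp
    have vint: "set_integrable lebesgue G v"
      unfolding set_integrable_def
    proof (rule Bochner_Integration.integrable_bound)
      show "integrable lebesgue (\<lambda>x. indicator G x *\<^sub>R 1 + indicator G x *\<^sub>R (\<bar>u x\<bar> powr p) :: real)"
        using up fin unfolding set_integrable_def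
        by (intro Bochner_Integration.integrable_add) (auto simp: less_top[symmetric])
      show "(\<lambda>x. indicator G x *\<^sub>R v x) \<in> borel_measurable lebesgue" using v by measurable
      \<comment> \<open>On a set of finite measure this gives integrability from membership in
        \<open>L^p\<close>.\<close>
      have "\<bar>t\<bar> \<le> 1 + \<bar>t\<bar> powr p" for t :: real
      proof (cases "\<bar>t\<bar> \<le> 1")
        case False
        then have "\<bar>t\<bar> powr 1 \<le> \<bar>t\<bar> powr p" using assms by (intro powr_mono) auto
        then show ?thesis using False by simp
      qed (simp add: add_increasing2)
      then show "AE x in lebesgue. norm (indicator G x *\<^sub>R v x) \<le> norm (indicator G x *\<^sub>R 1 + indicator G x *\<^sub>R (\<bar>u x\<bar> powr p) :: real)"
        by (auto simp: v_def indicator_def)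
    qed
    have vG: "set_average v G = uG"
      unfolding uG_def set_average_def set_lebesgue_integral_def
      by (intro arg_cong2[where f = divide] Bochner_Integration.integral_cong) (auto simp: v_def indicator_def)
    have I: "(\<integral>\<^sup>+x\<in>G. local_energy G \<tau> \<delta> p v x \<partial>lebesgue) = I"
      unfolding I_def local_energy_def
      by (intro nn_integral_cong) (auto simp: v_def indicator_def intro!: nn_integral_cong)
    have J: "(\<integral>\<^sup>+x\<in>G. ennreal (\<bar>v x - set_average v G\<bar> powr q) \<partial>lebesgue) = ?J"
      unfolding vG by (intro nn_integral_cong) (auto simp: v_def indicator_def)
    have bound: "?J \<le> ennreal (C' * A powr q)" if A: "0 < A" "I \<le> ennreal (A powr p)" for A
      using nn_integral_deviation_mean_le[OF v vint Gs fin pos _ _ C(2)[OF v vint A(1)]] A C(1) assms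
      by (simp add: I J C'_def mult.assoc)
    have "?J \<le> ennreal (C' * enn2real I powr (q / p))" if "I < \<infinity>"
    proof (cases "enn2real I = 0")
      case False
      then have I0: "0 < enn2real I" by (simp add: less_le)
      \<comment> \<open>The choice \<open>A = I^(1/p)\<close>, admissible because it is
        positive.\<close>
      have "?J \<le> ennreal (C' * (enn2real I powr (1 / p)) powr q)"
        using I0 that assms by (intro bound) (auto simp: powr_powr)
      then show ?thesis by (simp add: powr_powr)
    next
      case True
      then have "I = 0" using that by (auto simp: enn2real_eq_0_iff)
      \<comment> \<open>Every positive \<open>A\<close> is admissible when \<open>I = 0\<close>; the
        one with \<open>C' * A powr q = e\<close> makes the bound arbitrarily small.\<close>
      have "?J \<le> 0"
      proof (rule ennreal_le_epsilon)
        fix e :: real assume e: "0 < e"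
        have "?J \<le> ennreal (C' * ((e / C') powr (1 / q)) powr q)"
          using e C' \<open>I = 0\<close> by (intro bound) auto
        also have "C' * ((e / C') powr (1 / q)) powr q = e"
          using e C' assms by (simp add: powr_powr)
        finally show "?J \<le> 0 + ennreal e" by simp
      qed
      then show ?thesis by simp
    qed
    then show "let uG = (LINT x:G|lebesgue. u x) / measure lebesgue G;
          I = (\<integral>\<^sup>+ x\<in>G. (\<integral>\<^sup>+ y\<in>G \<inter> ball x (\<tau> * infdist x (frontier G)).
                 ennreal (\<bar>u x - u y\<bar> powr p / dist x y powr (real CARD('n) + \<delta> * p)) \<partial>lebesgue) \<partial>lebesgue)
      in I < \<infinity> \<longrightarrow>
         (\<integral>\<^sup>+ x\<in>G. ennreal (\<bar>u x - uG\<bar> powr q) \<partial>lebesgue) \<le> ennreal (C' * enn2real I powr (q / p))"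
      unfolding Let_def uG_def[symmetric] I_def[symmetric] by simp
  qed
qed

end
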